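(* Let $d\geq 2$, $N\geq 1$, let $A,B\in\mathbb{C}^{N,N}$ be simultaneously diagonalizable (over $\mathbb{C}$), let every eigenvalue of $A$ have positive real part, and let $S\in\mathbb{R}^{d,d}$ be skew-symmetric. Let $\theta\in C(\mathbb{R}^d,\mathbb{R})$ be a radial weight function of exponential growth rate $\eta\geq0$. Let $T(0)=I$ and, for $t>0$, $[T(t)v](x)=\int_{\mathbb{R}^d}H(x,\xi,t)v(\xi)\,d\xi$ with $$H(x,\xi,t)=(4\pi tA)^{-\frac d2}\exp\left(-Bt-(4tA)^{-1}|e^{tS}x-\xi|^2\right).$$ Then $(T(t))_{t\geq0}$ is a semigroup on each of the spaces $X=C_{\mathrm b}(\mathbb{R}^d,\mathbb{C}^N)$, $X=C_{\mathrm{ub}}(\mathbb{R}^d,\mathbb{C}^N)$ and $X=C_{\mathrm{rub}}(\mathbb{R}^d,\mathbb{C}^N)$ (all with the sup-norm); that is, $T(t):X\to X$ is linear and bounded for every $t\geq0$, $T(0)=I$, and $T(t)T(s)=T(t+s)$ for all $s,t\geq0$.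
   Context: $C_{\mathrm b}(\mathbb{R}^d,\mathbb{C}^N)$ is the space of bounded continuous functions with the sup-norm; $C_{\mathrm{ub}}(\mathbb{R}^d,\mathbb{C}^N)$ is its subspace of uniformly continuous functions; and $$C_{\mathrm{rub}}(\mathbb{R}^d,\mathbb{C}^N)=\Big\{v\in C_{\mathrm{ub}}(\mathbb{R}^d,\mathbb{C}^N):\lim_{t\to0}\sup_{x\in\mathbb{R}^d}|v(e^{-tS}x)-v(x)|=0\Big\}.$$ A function $\theta\in C(\mathbb{R}^d,\mathbb{R})$ is a weight function of exponential growth rate $\eta\geq0$ if $\theta>0$ and there is $C_\theta>0$ with $\theta(x+y)\leq C_\theta\theta(x)e^{\eta|y|}$ for all $x,y\in\mathbb{R}^d$; it is radial if $\theta(x)=\phi(|x|)$ for some $\phi:[0,\infty)\to\mathbb{R}$. (The function $\theta$ does not enter the conclusion.) Matrix powers: if $A=Y\,\mathrm{diag}(\lambda_k)\,Y^{-1}$ then $(4\pi tA)^{-d/2}=Y\,\mathrm{diag}\big((4\pi t\lambda_k)^{-d/2}\big)\,Y^{-1}$, with $z^{-d/2}=\exp(-\frac d2\mathrm{Log}\,z)$ and $\mathrm{Log}$ the principal logarithm. *)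

theory Defs
  imports "HOL-Analysis.Analysis"
begin

section \<open>Matrices\<close>

definition mat_exp :: "'a::real_normed_field^'n^'n \<Rightarrow> 'a^'n^'n" where
  "mat_exp M = (\<Sum>k. ((**) M ^^ k) (mat 1) /\<^sub>R fact k)"

definition diag_mat :: "('n \<Rightarrow> 'a::zero) \<Rightarrow> 'a^'n^'n" where
  "diag_mat l = (\<chi> i j. if i = j then l i else 0)"

definition simultaneously_diagonalizable :: "complex^'n^'n \<Rightarrow> complex^'n^'n \<Rightarrow> bool" where
  "simultaneously_diagonalizable A B \<longleftrightarrow>
     (\<exists>Y::complex^'n^'n. invertible Y \<and>
        (\<exists>a. A = Y ** diag_mat a ** matrix_inv Y) \<and>
        (\<exists>b. B = Y ** diag_mat b ** matrix_inv Y))"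

definition mat_eigenvalue :: "complex^'n^'n \<Rightarrow> complex \<Rightarrow> bool" where
  "mat_eigenvalue A \<mu> \<longleftrightarrow> (\<exists>w. w \<noteq> 0 \<and> A *v w = \<mu> *s w)"

definition skew_symmetric :: "real^'d^'d \<Rightarrow> bool" where
  "skew_symmetric S \<longleftrightarrow> transpose S = - S"

text \<open>The value does not depend on the choice of the diagonalization, see
  \<open>diag_fun_eq\<close> below; it is unspecified if the matrix is not diagonalizable.\<close>

definition diag_fun :: "(complex \<Rightarrow> complex) \<Rightarrow> complex^'n^'n \<Rightarrow> complex^'n^'n" where
  "diag_fun f M =
     (THE R. \<exists>(Y::complex^'n^'n) l. invertible Y \<and> M = Y ** diag_mat l ** matrix_inv Y \<and>
           R = Y ** diag_mat (\<lambda>k. f (l k)) ** matrix_inv Y)"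

lemma invertible_inverse:
  fixes Y :: "complex^'n^'n"
  assumes "invertible Y"
  shows "Y ** matrix_inv Y = mat 1" "matrix_inv Y ** Y = mat 1"
  using someI_ex[OF assms[unfolded invertible_def]] by (simp_all add: matrix_inv_def)

lemma diag_fun_eq:
  fixes Y M :: "complex^'n^'n"
  assumes Y: "invertible Y" and M: "M = Y ** diag_mat l ** matrix_inv Y"
  shows "diag_fun f M = Y ** diag_mat (\<lambda>k. f (l k)) ** matrix_inv Y"
  unfolding diag_fun_def
proof (rule the_equality)
  show "\<exists>(Y'::complex^'n^'n) l'. invertible Y' \<and> M = Y' ** diag_mat l' ** matrix_inv Y' \<and>
      Y ** diag_mat (\<lambda>k. f (l k)) ** matrix_inv Y =
      Y' ** diag_mat (\<lambda>k. f (l' k)) ** matrix_inv Y'"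
    using Y M by blast
next
  fix R
  assume "\<exists>(Y::complex^'n^'n) l. invertible Y \<and> M = Y ** diag_mat l ** matrix_inv Y \<and>
      R = Y ** diag_mat (\<lambda>k. f (l k)) ** matrix_inv Y"
  then obtain Z :: "complex^'n^'n" and m where Z: "invertible Z" "M = Z ** diag_mat m ** matrix_inv Z"
    and R: "R = Z ** diag_mat (\<lambda>k. f (m k)) ** matrix_inv Z" by blast
  define P where "P = matrix_inv Z ** Y"
  note iY = invertible_inverse[OF Y] and iZ = invertible_inverse[OF Z(1)]
  have left: "(P ** diag_mat h) $ i $ j = P $ i $ j * h j" for h i j
    by (simp add: matrix_matrix_mult_def diag_mat_def if_distrib cong: if_cong)
  have right: "(diag_mat h ** P) $ i $ j = h i * P $ i $ j" for h i j
    by (simp add: matrix_matrix_mult_def diag_mat_def if_distrib[of "\<lambda>x. x * _"] cong: if_cong)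
  have "P ** diag_mat l = matrix_inv Z ** (Y ** diag_mat l ** matrix_inv Y) ** Y"
    unfolding P_def by (metis iY(2) matrix_mul_assoc matrix_mul_rid)
  also have "\<dots> = matrix_inv Z ** (Z ** diag_mat m ** matrix_inv Z) ** Y"
    using M Z by simp
  also have "\<dots> = diag_mat m ** P"
    unfolding P_def by (metis iZ(2) matrix_mul_assoc matrix_mul_lid)
  finally have eq: "P ** diag_mat l = diag_mat m ** P" .
  have "P $ i $ j * l j = m i * P $ i $ j" for i j
    by (metis eq left right)
  then have "P $ i $ j * f (l j) = f (m i) * P $ i $ j" for i j
    by (metis mult.commute mult_cancel_left)
  then have "P ** diag_mat (\<lambda>k. f (l k)) = diag_mat (\<lambda>k. f (m k)) ** P"
    by (simp add: vec_eq_iff left right)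
  then have "Z ** (diag_mat (\<lambda>k. f (m k)) ** P) ** matrix_inv Y =
      Z ** (P ** diag_mat (\<lambda>k. f (l k))) ** matrix_inv Y" by simp
  moreover have "Z ** (diag_mat (\<lambda>k. f (m k)) ** P) ** matrix_inv Y = R"
    unfolding P_def R by (metis iY(1) matrix_mul_assoc matrix_mul_rid)
  moreover have "Z ** (P ** diag_mat (\<lambda>k. f (l k))) ** matrix_inv Y =
      Y ** diag_mat (\<lambda>k. f (l k)) ** matrix_inv Y"
    unfolding P_def by (metis iZ(1) matrix_mul_assoc matrix_mul_lid)
  ultimately show "R = Y ** diag_mat (\<lambda>k. f (l k)) ** matrix_inv Y" by simp
qed

text \<open>The power \<open>M\<close> to the \<open>-d/2\<close>, taken with the principal logarithm \<open>Ln\<close>.\<close>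

definition mat_neg_half_power :: "nat \<Rightarrow> complex^'n^'n \<Rightarrow> complex^'n^'n" where
  "mat_neg_half_power d M = diag_fun (\<lambda>z. exp (- (of_nat d / 2) * Ln z)) M"


section \<open>Function spaces\<close>

definition sup_norm :: "(real^'d \<Rightarrow> complex^'n) \<Rightarrow> real" where
  "sup_norm v = (SUP x. norm (v x))"

definition C_b :: "(real^'d \<Rightarrow> complex^'n) set" where
  "C_b = bcontfun"

definition C_ub :: "(real^'d \<Rightarrow> complex^'n) set" where
  "C_ub = {v \<in> C_b. uniformly_continuous_on UNIV v}"

definition C_rub :: "real^'d^'d \<Rightarrow> (real^'d \<Rightarrow> complex^'n) set" where
  "C_rub S = {v \<in> C_ub.
     ((\<lambda>t::real. SUP x. norm (v (mat_exp (- t *\<^sub>R S) *v x) - v x)) \<longlongrightarrow> 0) (at 0)}"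


section \<open>Weight functions\<close>

definition weight_function :: "real \<Rightarrow> (real^'d \<Rightarrow> real) \<Rightarrow> bool" where
  "weight_function \<eta> \<theta> \<longleftrightarrow> \<eta> \<ge> 0 \<and> continuous_on UNIV \<theta> \<and> (\<forall>x. \<theta> x > 0) \<and>
     (\<exists>C>0. \<forall>x y. \<theta> (x + y) \<le> C * \<theta> x * exp (\<eta> * norm y))"

text \<open>Only the values of \<open>\<phi>\<close> on the nonnegative reals are used.\<close>

definition radial :: "(real^'d \<Rightarrow> real) \<Rightarrow> bool" where
  "radial \<theta> \<longleftrightarrow> (\<exists>\<phi>::real \<Rightarrow> real. \<forall>x. \<theta> x = \<phi> (norm x))"


section \<open>Semigroups of bounded operators\<close>

definition bounded_linear_operator_on ::
  "(real^'d \<Rightarrow> complex^'n) set \<Rightarrow> ((real^'d \<Rightarrow> complex^'n) \<Rightarrow> real^'d \<Rightarrow> complex^'n) \<Rightarrow> bool" where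
  "bounded_linear_operator_on X L \<longleftrightarrow>
     (\<forall>v\<in>X. L v \<in> X) \<and>
     (\<forall>u\<in>X. \<forall>v\<in>X. L (\<lambda>x. u x + v x) = (\<lambda>x. L u x + L v x)) \<and>
     (\<forall>c. \<forall>v\<in>X. L (\<lambda>x. c *s v x) = (\<lambda>x. c *s L v x)) \<and>
     (\<exists>K. \<forall>v\<in>X. sup_norm (L v) \<le> K * sup_norm v)"

definition operator_semigroup_on ::
  "(real^'d \<Rightarrow> complex^'n) set \<Rightarrow>
     (real \<Rightarrow> (real^'d \<Rightarrow> complex^'n) \<Rightarrow> real^'d \<Rightarrow> complex^'n) \<Rightarrow> bool" where
  "operator_semigroup_on X T \<longleftrightarrow>
     (\<forall>t\<ge>0. bounded_linear_operator_on X (T t)) \<and>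
     (\<forall>v\<in>X. T 0 v = v) \<and>
     (\<forall>s\<ge>0. \<forall>t\<ge>0. \<forall>v\<in>X. T t (T s v) = T (t + s) v)"


section \<open>The heat kernel of the Ornstein-Uhlenbeck operator\<close>

definition heat_kernel ::
  "complex^'n^'n \<Rightarrow> complex^'n^'n \<Rightarrow> real^'d^'d \<Rightarrow> real^'d \<Rightarrow> real^'d \<Rightarrow> real \<Rightarrow> complex^'n^'n" where
  "heat_kernel A B S x \<xi> t =
     mat_neg_half_power CARD('d) ((4 * pi * t) *\<^sub>R A) **
     mat_exp (- (t *\<^sub>R B) -
       (norm (mat_exp (t *\<^sub>R S) *v x - \<xi>))\<^sup>2 *\<^sub>R matrix_inv ((4 * t) *\<^sub>R A))"

text \<open>The Bochner integral of a function that is not integrable is \<open>0\<close>, so \<open>ou_semigroup\<close> is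
  meaningful only where \<open>ou_integrable\<close> holds. Only \<open>t \<ge> 0\<close> is of interest.\<close>

definition ou_integrable ::
  "complex^'n^'n \<Rightarrow> complex^'n^'n \<Rightarrow> real^'d^'d \<Rightarrow> real \<Rightarrow> (real^'d \<Rightarrow> complex^'n) \<Rightarrow> bool" where
  "ou_integrable A B S t v \<longleftrightarrow>
     (\<forall>x. integrable lborel (\<lambda>\<xi>. heat_kernel A B S x \<xi> t *v v \<xi>))"

definition ou_semigroup ::
  "complex^'n^'n \<Rightarrow> complex^'n^'n \<Rightarrow> real^'d^'d \<Rightarrow>
     real \<Rightarrow> (real^'d \<Rightarrow> complex^'n) \<Rightarrow> real^'d \<Rightarrow> complex^'n" where
  "ou_semigroup A B S t v =
     (if t = 0 then v else (\<lambda>x. LINT \<xi>|lborel. heat_kernel A B S x \<xi> t *v v \<xi>))"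

end

theory Submission
  imports Defs "HOL-Probability.Distributions"
begin

text \<open>Diagonalizing \<open>A\<close> and \<open>B\<close> simultaneously turns the heat kernel into
  \<open>H t (R t x - \<xi>)\<close>, where \<open>R t\<close> is the orthogonal matrix \<open>exp (t S)\<close> and \<open>H t\<close> is the
  radial matrix function whose \<open>k\<close>-th diagonal entry, in the common eigenbasis, is
  \<open>exp (- t b\<^sub>k)\<close> times the Gaussian of complex variance \<open>t a\<^sub>k\<close>. So \<open>T t\<close> is the convolution with
  the integrable kernel \<open>H t\<close> followed by the substitution \<open>R t\<close>, which gives boundedness and the
  invariance of the three spaces. As \<open>H t\<close> is radial, the convolution commutes with rotations, and
  the semigroup law reduces to \<open>H t * H s = H (t + s)\<close>. By completing the square this
  needs only that a Gaussian of complex variance has integral 1.\<close>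

section \<open>Matrix exponentials\<close>

text \<open>That a Gaussian of complex variance has integral 1 is proved without contour shifts or
  analytic continuation. For \<open>norm (1 - c) < 1\<close> the integral of
  \<open>exp (- c * x\<^sup>2 / 2)\<close> is a power series in \<open>1 - c\<close> whose
  coefficients come from the even moments of the normal distribution, and it is
  \<open>sqrt (2 * pi)\<close> times the binomial series of \<open>c powr (- 1 / 2)\<close>.
  Dividing by a suitable positive real brings any \<open>c\<close> with positive real part into that
  disc, and this amounts to rescaling the line. The delicate point is the principal logarithm, which
  is not additive on products in general. In each eigencomponent, however, all variances are
  positive multiples of one \<open>a\<^sub>k\<close>, so their logarithms differ by real numbers and
  the normalizing factors multiply without branch corrections. The space \<open>C_rub S\<close>
  needs one more fact: the rotations \<open>R t\<close> commute with those in its definition, since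
  all of them are exponentials of multiples of \<open>S\<close>.\<close>

lemma bounded_bilinear_matrix_matrix_mult:
  "bounded_bilinear ((**) :: 'a::{real_normed_field,euclidean_space}^'n^'m \<Rightarrow> 'a^'k^'n \<Rightarrow> 'a^'k^'m)"
proof -
  have "bilinear ((**) :: 'a^'n^'m \<Rightarrow> 'a^'k^'n \<Rightarrow> 'a^'k^'m)"
    unfolding bilinear_def
    by (auto intro!: linearI simp: matrix_matrix_mult_def vec_eq_iff algebra_simps sum.distrib
        scaleR_sum_right)
  then show ?thesis
    by (simp add: bilinear_conv_bounded_bilinear)
qed

lemma bounded_bilinear_matrix_vector_mult:
  "bounded_bilinear ((*v) :: 'a::{real_normed_field,euclidean_space}^'n^'m \<Rightarrow> 'a^'n \<Rightarrow> 'a^'m)"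
proof -
  have "bilinear ((*v) :: 'a^'n^'m \<Rightarrow> 'a^'n \<Rightarrow> 'a^'m)"
    unfolding bilinear_def
    by (auto intro!: linearI simp: matrix_vector_mult_def vec_eq_iff algebra_simps sum.distrib
        scaleR_sum_right)
  then show ?thesis
    by (simp add: bilinear_conv_bounded_bilinear)
qed

abbreviation mat_pow :: "'a::semiring_1^'n^'n \<Rightarrow> nat \<Rightarrow> 'a^'n^'n" where
  "mat_pow M k \<equiv> ((**) M ^^ k) (mat 1)"

lemma mat_pow_add: "mat_pow M (i + j) = mat_pow M i ** mat_pow M j"
  by (induction i) (simp_all add: matrix_mul_assoc)

text \<open>Powers grow by factors on the left, while transposition reverses products; this
  reconciles the two.\<close>

lemma mat_pow_commute: "M ** mat_pow M k = mat_pow M k ** M"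
  using mat_pow_add[of k 1 M] mat_pow_add[of 1 k M] by simp

lemma mat_pow_scaleR:
  fixes M :: "'a::real_algebra_1^'n^'n"
  shows "mat_pow (t *\<^sub>R M) k = t ^ k *\<^sub>R mat_pow M k"
  by (induction k) (simp_all add: scalar_matrix_assoc [symmetric] matrix_scalar_ac)

lemma transpose_mat_pow:
  fixes M :: "'a::comm_semiring_1^'n^'n"
  shows "transpose (mat_pow M k) = mat_pow (transpose M) k"
  proof (induction k)
  case (Suc k)
  then show ?case
    using mat_pow_commute[of "transpose M" k] by (simp add: matrix_transpose_mul)
qed simp

text \<open>The norm is the Euclidean one of the entries, which is submultiplicative here only up to
  the constant \<open>C\<close> of the bilinear bound. Hence \<open>K = norm M * C\<close>, and
  \<open>norm (mat 1)\<close> remains as a factor.\<close>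

lemma norm_mat_pow_le:
  fixes M :: "'a::{real_normed_field,euclidean_space}^'n^'n"
  obtains K where "0 \<le> K" "\<And>k. norm (mat_pow M k) \<le> norm (mat 1 :: 'a^'n^'n) * K ^ k"
proof -
  interpret bounded_bilinear "(**) :: 'a^'n^'n \<Rightarrow> 'a^'n^'n \<Rightarrow> 'a^'n^'n"
    by (rule bounded_bilinear_matrix_matrix_mult)
  obtain C where C: "C > 0" "\<And>(X::'a^'n^'n) (Y::'a^'n^'n). norm (X ** Y) \<le> norm X * norm Y * C"
    using pos_bounded by blast
  have "norm (mat_pow M k) \<le> norm (mat 1 :: 'a^'n^'n) * (norm M * C) ^ k" for k
  proof (induction k)
    case (Suc k)
    have "norm (mat_pow M (Suc k)) \<le> norm M * norm (mat_pow M k) * C"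
      using C(2) by simp
    also have "\<dots> \<le> norm M * (norm (mat 1 :: 'a^'n^'n) * (norm M * C) ^ k) * C"
      using C(1) Suc by (intro mult_right_mono mult_left_mono) auto
    finally show ?case by (simp add: mult_ac)
  qed simp
  moreover have "0 \<le> norm M * C" using C(1) by simp
  ultimately show ?thesis using that by blast
qed

lemma summable_norm_mat_exp:
  fixes M :: "'a::{real_normed_field,euclidean_space}^'n^'n"
  shows "summable (\<lambda>k. norm (mat_pow M k /\<^sub>R fact k))"
proof -
  obtain K where K: "0 \<le> K" "\<And>k. norm (mat_pow M k) \<le> norm (mat 1 :: 'a^'n^'n) * K ^ k"
    by (rule norm_mat_pow_le[of M]) blast
  have "summable (\<lambda>k. norm (mat 1 :: 'a^'n^'n) * (K ^ k /\<^sub>R fact k))"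
    by (intro summable_mult summable_exp_generic)
  then show ?thesis
    by (rule summable_comparison_test')
       (use K in \<open>auto simp: divide_simps intro!: mult_left_mono\<close>)
qed

lemma mat_exp_sums:
  fixes M :: "'a::{real_normed_field,euclidean_space}^'n^'n"
  shows "(\<lambda>k. mat_pow M k /\<^sub>R fact k) sums mat_exp M"
  unfolding mat_exp_def by (rule summable_sums[OF summable_norm_cancel[OF summable_norm_mat_exp]])

lemma mat_exp_0: "mat_exp (0 :: 'a::{real_normed_field,euclidean_space}^'n^'n) = mat 1"
proof -
  have *: "mat_pow (0 :: 'a^'n^'n) k /\<^sub>R fact k = (if k = 0 then mat 1 else 0)" for k
    by (cases k) auto
  have "(\<lambda>k. mat_pow (0 :: 'a^'n^'n) k /\<^sub>R fact k) sums mat 1"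
    unfolding * by (rule sums_single)
  then show ?thesis
    using mat_exp_sums sums_unique2 by blast
qed

lemma transpose_mat_exp:
  fixes M :: "'a::{real_normed_field,euclidean_space}^'n^'n"
  shows "transpose (mat_exp M) = mat_exp (transpose M)"
proof -
  have "linear (transpose :: 'a^'n^'n \<Rightarrow> 'a^'n^'n)"
    by (rule linearI) (simp_all add: transpose_def vec_eq_iff)
  then have bl: "bounded_linear (transpose :: 'a^'n^'n \<Rightarrow> 'a^'n^'n)"
    by (simp add: linear_conv_bounded_linear)
  have "(\<lambda>k. transpose (mat_pow M k /\<^sub>R fact k)) sums transpose (mat_exp M)"
    by (rule bounded_linear.sums[OF bl mat_exp_sums])
  moreover have "transpose (mat_pow M k /\<^sub>R fact k) = mat_pow (transpose M) k /\<^sub>R fact k" for k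
    by (simp add: linear_scale[OF \<open>linear transpose\<close>] transpose_mat_pow)
  ultimately show ?thesis
    using mat_exp_sums[of "transpose M"] sums_unique2 by auto
qed

text \<open>Cauchy product of the two exponential series, taken entry by entry, where the terms are
  scalars. Both factors involve powers of the same \<open>M\<close>, so the binomial theorem for
  \<open>s\<close> and \<open>t\<close> sums each diagonal. This is the group law of the
  rotations.\<close>

lemma mat_exp_scaleR_add:
  fixes M :: "'a::{real_normed_field,euclidean_space}^'n^'n"
  shows "mat_exp (s *\<^sub>R M) ** mat_exp (t *\<^sub>R M) = mat_exp ((s + t) *\<^sub>R M)"
proof -
  define p where "p = (\<lambda>u k. mat_pow (u *\<^sub>R M) k /\<^sub>R fact k)"
  have entry: "bounded_linear (\<lambda>X :: 'a^'n^'n. X $ i $ j)" for i j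
    by (intro bounded_linear_compose[OF bounded_linear_vec_nth bounded_linear_vec_nth])
  have sums: "(\<lambda>k. p u k $ i $ j) sums (mat_exp (u *\<^sub>R M) $ i $ j)" for u i j
    unfolding p_def by (rule bounded_linear.sums[OF entry mat_exp_sums])
  have summ: "summable (\<lambda>k. norm (p u k $ i $ j))" for u i j
  proof (rule summable_comparison_test')
    show "summable (\<lambda>k. norm (p u k))"
      unfolding p_def by (rule summable_norm_mat_exp)
    show "norm (norm (p u k $ i $ j)) \<le> norm (p u k)" if "k \<ge> 0" for k
      using order_trans[OF Finite_Cartesian_Product.norm_nth_le[of "p u k $ i" j]
          Finite_Cartesian_Product.norm_nth_le[of "p u k" i]] by simp
  qed
  have binom: "(\<Sum>m\<le>k. p s m ** p t (k - m)) = p (s + t) k" for k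
  proof -
    have "p s m ** p t (k - m) = (of_nat (k choose m) * s ^ m * t ^ (k - m) / fact k) *\<^sub>R mat_pow M k"
      if "m \<le> k" for m
    proof -
      have "p s m ** p t (k - m) = (s ^ m * t ^ (k - m) / (fact m * fact (k - m))) *\<^sub>R
          (mat_pow M m ** mat_pow M (k - m))"
        unfolding p_def mat_pow_scaleR
        by (simp add: scalar_matrix_assoc [symmetric] matrix_scalar_ac divide_inverse mult_ac)
      also have "mat_pow M m ** mat_pow M (k - m) = mat_pow M k"
        using mat_pow_add[of m "k - m" M] that by simp
      finally show ?thesis
        using that by (simp add: binomial_fact mult_ac)
    qed
    then have "(\<Sum>m\<le>k. p s m ** p t (k - m)) =
        (\<Sum>m\<le>k. (of_nat (k choose m) * s ^ m * t ^ (k - m) / fact k) *\<^sub>R mat_pow M k)"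
      by (intro sum.cong) auto
    also have "\<dots> = ((s + t) ^ k / fact k) *\<^sub>R mat_pow M k"
      by (simp add: binomial_ring scaleR_left.sum [symmetric] sum_divide_distrib)
    finally show ?thesis
      unfolding p_def mat_pow_scaleR by (simp add: divide_inverse mult_ac)
  qed
  have "(mat_exp (s *\<^sub>R M) ** mat_exp (t *\<^sub>R M)) $ i $ j = mat_exp ((s + t) *\<^sub>R M) $ i $ j" for i j
  proof -
    have "(\<lambda>k. \<Sum>m\<le>k. p s m $ i $ l * p t (k - m) $ l $ j) sums
        (mat_exp (s *\<^sub>R M) $ i $ l * mat_exp (t *\<^sub>R M) $ l $ j)" for l
      unfolding sums_unique[OF sums] by (rule Cauchy_product_sums[OF summ summ])
    then have "(\<lambda>k. \<Sum>l\<in>UNIV. \<Sum>m\<le>k. p s m $ i $ l * p t (k - m) $ l $ j) sums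
        (\<Sum>l\<in>UNIV. mat_exp (s *\<^sub>R M) $ i $ l * mat_exp (t *\<^sub>R M) $ l $ j)"
      by (rule sums_sum)
    moreover have "(\<Sum>l\<in>UNIV. \<Sum>m\<le>k. p s m $ i $ l * p t (k - m) $ l $ j) = p (s + t) k $ i $ j" for k
      unfolding binom [symmetric] by (subst sum.swap) (simp add: matrix_matrix_mult_def)
    ultimately show ?thesis
      using sums[of "s + t" i j] sums_unique2 by (auto simp: matrix_matrix_mult_def)
  qed
  then show ?thesis by (simp add: vec_eq_iff)
qed

text \<open>Transposition turns the exponential of \<open>t *\<^sub>R S\<close> into that of
  \<open>- t *\<^sub>R S\<close>, which is its inverse by the group law.\<close>

lemma orthogonal_mat_exp_skew:
  assumes "skew_symmetric S"
  shows "orthogonal_matrix (mat_exp (t *\<^sub>R S))"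
proof -
  have "linear (transpose :: real^'a^'a \<Rightarrow> real^'a^'a)"
    by (rule linearI) (simp_all add: transpose_def vec_eq_iff)
  then have "transpose (t *\<^sub>R S) = (- t) *\<^sub>R S"
    using assms by (simp add: skew_symmetric_def linear_scale)
  then show ?thesis
    using mat_exp_scaleR_add[of t S "- t"] mat_exp_scaleR_add[of "- t" S t]
    by (simp add: orthogonal_matrix_def transpose_mat_exp mat_exp_0)
qed

section \<open>Functions of a diagonalizable matrix\<close>

lemma diag_mat_mult: "diag_mat f ** diag_mat g = diag_mat (\<lambda>k. f k * (g k :: 'a::semiring_1))"
  by (simp add: vec_eq_iff matrix_matrix_mult_def diag_mat_def if_distrib[of "\<lambda>x. x * _"] 
      if_distrib[of "\<lambda>x. _ * x"] cong: if_cong)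

lemma diag_mat_1: "diag_mat (\<lambda>k. 1) = mat 1"
  by (simp add: diag_mat_def mat_def)

lemma vec_nth_vec_lambda: "($) (vec_lambda f) = f"
  by (simp add: fun_eq_iff)

text \<open>The diagonal is a vector rather than a function, so that for fixed \<open>Y\<close> this
  is a bounded linear map between Euclidean spaces. Series and Bochner integrals then pass through
  it.\<close>

definition diag_conj :: "complex^'n^'n \<Rightarrow> complex^'n \<Rightarrow> complex^'n^'n" where
  "diag_conj Y c = Y ** diag_mat (($) c) ** matrix_inv Y"

lemma bounded_linear_diag_conj: "bounded_linear (diag_conj Y)"
proof -
  have "linear (\<lambda>c :: complex^'n. diag_mat (($) c))"
    by (rule linearI) (simp_all add: diag_mat_def vec_eq_iff)
  then have "bounded_linear (\<lambda>c :: complex^'n. diag_mat (($) c))"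
    by (simp add: linear_conv_bounded_linear)
  then show ?thesis
    unfolding diag_conj_def
    by (intro bounded_bilinear.bounded_linear_left[OF bounded_bilinear_matrix_matrix_mult, THEN bounded_linear_compose]
        bounded_bilinear.bounded_linear_right[OF bounded_bilinear_matrix_matrix_mult, THEN bounded_linear_compose])
qed

context
  fixes Y :: "complex^'n^'n"
  assumes Y: "invertible Y"
begin

lemma diag_conj_mult: "diag_conj Y c ** diag_conj Y c' = diag_conj Y (\<chi> k. c $ k * c' $ k)"
proof -
  have "diag_conj Y c ** diag_conj Y c' =
      Y ** (diag_mat (($) c) ** (matrix_inv Y ** Y) ** diag_mat (($) c')) ** matrix_inv Y"
    by (simp add: diag_conj_def matrix_mul_assoc)
  then show ?thesis
    by (simp add: invertible_inverse[OF Y] diag_mat_mult diag_conj_def vec_nth_vec_lambda)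
qed

lemma diag_conj_1: "diag_conj Y (\<chi> k. 1) = mat 1"
  by (simp add: diag_conj_def vec_nth_vec_lambda diag_mat_1 invertible_inverse[OF Y])

text \<open>The scalar exponential series converges in every coordinate, and the bounded linear map
  \<open>diag_conj Y\<close> carries it to the matrix series.\<close>

lemma mat_exp_diag_conj: "mat_exp (diag_conj Y c) = diag_conj Y (\<chi> k. exp (c $ k))"
proof -
  have pow: "mat_pow (diag_conj Y c) m = diag_conj Y (\<chi> k. c $ k ^ m)" for m
    by (induction m) (simp_all add: diag_conj_1 diag_conj_mult)
  have "(\<lambda>m. \<chi> k. c $ k ^ m /\<^sub>R fact m) sums (\<chi> k. exp (c $ k))"
  proof -
    have "(\<lambda>N. \<chi> k. \<Sum>m<N. c $ k ^ m /\<^sub>R fact m) \<longlonglongrightarrow> (\<chi> k. exp (c $ k))"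
      using exp_converges[unfolded sums_def] by (intro tendsto_vec_lambda)
    moreover have "(\<Sum>m<N. \<chi> k. c $ k ^ m /\<^sub>R fact m) = (\<chi> k. \<Sum>m<N. c $ k ^ m /\<^sub>R fact m)" for N
      by (simp add: vec_eq_iff)
    ultimately show ?thesis by (simp add: sums_def)
  qed
  from bounded_linear.sums[OF bounded_linear_diag_conj this]
  have "(\<lambda>m. diag_conj Y (\<chi> k. c $ k ^ m /\<^sub>R fact m)) sums diag_conj Y (\<chi> k. exp (c $ k))" .
  moreover have "diag_conj Y (\<chi> k. c $ k ^ m /\<^sub>R fact m) = mat_pow (diag_conj Y c) m /\<^sub>R fact m" for m
    unfolding pow linear_scale[OF bounded_linear.linear[OF bounded_linear_diag_conj], symmetric]
    by (rule arg_cong[where f = "diag_conj Y"]) (simp add: vec_eq_iff)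
  ultimately show ?thesis
    using mat_exp_sums[of "diag_conj Y c"] sums_unique2 by auto
qed

lemma matrix_inv_diag_conj:
  assumes "\<And>k. c $ k \<noteq> 0"
  shows "matrix_inv (diag_conj Y c) = diag_conj Y (\<chi> k. inverse (c $ k))"
proof -
  let ?M = "diag_conj Y c" and ?N = "diag_conj Y (\<chi> k. inverse (c $ k))"
  have MN: "?M ** ?N = mat 1" "?N ** ?M = mat 1"
    using assms by (simp_all add: diag_conj_mult diag_conj_1)
  then have "invertible ?M"
    by (auto simp: invertible_def)
  \<comment> \<open>\<open>matrix_inv\<close> merely selects some two-sided inverse; cancelling from
    the left identifies it with \<open>?N\<close>.\<close>
  then have "?N ** (?M ** matrix_inv ?M) = ?N"
    by (simp add: invertible_inverse)
  then show ?thesis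
    by (simp add: matrix_mul_assoc MN)
qed

text \<open>The eigenvector is the \<open>k\<close>-th column of \<open>Y\<close>. This transfers
  the assumption on the spectrum of \<open>A\<close> to the diagonal entries.\<close>

lemma mat_eigenvalue_diag_conj: "mat_eigenvalue (diag_conj Y c) (c $ k)"
proof -
  define w where "w = Y *v axis k 1"
  have "matrix_inv Y *v w = axis k 1"
    by (simp add: w_def matrix_vector_mul_assoc invertible_inverse[OF Y])
  then have 1: "w \<noteq> 0"
    by (metis axis_eq_0_iff matrix_vector_mult_0_right zero_neq_one)
  have "diag_mat (($) c) *v axis k 1 = c $ k *s axis k (1::complex)"
    by (auto simp: vec_eq_iff matrix_vector_mult_def diag_mat_def axis_def if_distrib[of "\<lambda>x. _ * x"] cong: if_cong)
  then have "diag_conj Y c *v w = c $ k *s w"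
    by (simp add: w_def diag_conj_def matrix_vector_mul_assoc [symmetric] invertible_inverse[OF Y]
        vector_scalar_commute \<open>matrix_inv Y *v w = axis k 1\<close>[unfolded w_def, simplified])
  then show ?thesis
    using 1 by (auto simp: mat_eigenvalue_def)
qed

lemma diag_fun_diag_conj: "diag_fun f (diag_conj Y c) = diag_conj Y (\<chi> k. f (c $ k))"
  by (subst diag_fun_eq[OF Y]) (simp_all add: diag_conj_def vec_nth_vec_lambda)

end

section \<open>Invariance of Lebesgue measure\<close>

lemma nn_integral_lborel_translation:
  fixes F :: "'a::euclidean_space \<Rightarrow> ennreal"
  assumes [measurable]: "F \<in> borel_measurable borel"
  shows "(\<integral>\<^sup>+x. F (a + x) \<partial>lborel) = (\<integral>\<^sup>+x. F x \<partial>lborel)"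
proof -
  have "(\<integral>\<^sup>+x. F x \<partial>lborel) = (\<integral>\<^sup>+x. F x \<partial>distr lborel borel ((+) a))"
    by (simp add: lborel_distr_plus)
  also have "\<dots> = (\<integral>\<^sup>+x. F (a + x) \<partial>lborel)"
    by (simp add: nn_integral_distr)
  finally show ?thesis by simp
qed

lemma continuous_on_orthogonal_transformation:
  fixes f :: "'a::euclidean_space \<Rightarrow> 'a"
  shows "orthogonal_transformation f \<Longrightarrow> continuous_on X f"
  by (simp add: orthogonal_transformation_linear linear_continuous_on linear_conv_bounded_linear[symmetric])

text \<open>The usual proof of the uniqueness of Haar measure, with the indicator of the unit ball as the
  auxiliary function; \<open>measure_orthogonal_image\<close> would need a well-ordered index type.\<close>

lemma nn_integral_lborel_orthogonal:
  fixes f :: "'a::euclidean_space \<Rightarrow> 'a" and F :: "'a \<Rightarrow> ennreal"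
  assumes f: "orthogonal_transformation f" and [measurable]: "F \<in> borel_measurable borel"
  shows "(\<integral>\<^sup>+x. F (f x) \<partial>lborel) = (\<integral>\<^sup>+x. F x \<partial>lborel)"
proof -
  define g :: "'a \<Rightarrow> ennreal" where "g = indicator (ball 0 1)"
  define V where "V = (\<integral>\<^sup>+x. g x \<partial>lborel)"
  have [measurable]: "g \<in> borel_measurable borel"
    unfolding g_def by (rule borel_measurable_indicator) (rule borel_open[OF open_ball])
  have lin: "linear f"
    using f by (rule orthogonal_transformation_linear)
  have [measurable]: "f \<in> borel_measurable borel"
    by (intro borel_measurable_continuous_onI continuous_on_orthogonal_transformation f)
  have g: "g x = g y" if "norm x = norm y" for x y
    using that by (simp add: g_def indicator_def)
  have V: "V = emeasure lborel (ball (0::'a) 1)"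
    by (simp add: V_def g_def)
  have "V > 0"
    unfolding V using emeasure_ball[of 1 "0::'a"] by simp
  then have "V \<noteq> 0" by simp
  moreover have "V \<noteq> \<infinity>"
    unfolding V using emeasure_lborel_ball_finite[of "0::'a" 1] by simp
  moreover have "(\<integral>\<^sup>+x. F (f x) \<partial>lborel) * V = (\<integral>\<^sup>+x. F x \<partial>lborel) * V"
  proof -
    have "(\<integral>\<^sup>+x. F (f x) \<partial>lborel) * V = (\<integral>\<^sup>+x. \<integral>\<^sup>+y. F (f x) * g y \<partial>lborel \<partial>lborel)"
      by (simp add: V_def nn_integral_cmult nn_integral_multc)
    also have "\<dots> = (\<integral>\<^sup>+x. \<integral>\<^sup>+y. F (f x) * g (f x - y) \<partial>lborel \<partial>lborel)"
    proof (rule nn_integral_cong)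
      fix x
      have "(\<integral>\<^sup>+y. F (f x) * g y \<partial>lborel) = (\<integral>\<^sup>+y. F (f x) * g (- f x + y) \<partial>lborel)"
        by (rule nn_integral_lborel_translation[symmetric]) measurable
      also have "\<dots> = (\<integral>\<^sup>+y. F (f x) * g (f x - y) \<partial>lborel)"
        by (simp add: g[OF norm_minus_commute, of _ "f x"])
      finally show "(\<integral>\<^sup>+y. F (f x) * g y \<partial>lborel) = \<dots>" .
    qed
    also have "\<dots> = (\<integral>\<^sup>+y. \<integral>\<^sup>+x. F (f x) * g (f x - y) \<partial>lborel \<partial>lborel)"
      by (rule lborel_pair.Fubini') measurable
    also have "\<dots> = (\<integral>\<^sup>+y. \<integral>\<^sup>+x. F (y + f x) * g x \<partial>lborel \<partial>lborel)"
    proof (rule nn_integral_cong)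
      fix y
      \<comment> \<open>Translating by a preimage of \<open>y\<close> removes \<open>y\<close> and
        \<open>f\<close> from the indicator: \<open>f (z + x) - y = f x\<close> has the norm of
        \<open>x\<close>.\<close>
      obtain z where z: "y = f z"
        using orthogonal_transformation_surj[OF f] by (auto simp: surj_def)
      have "(\<integral>\<^sup>+x. F (f x) * g (f x - y) \<partial>lborel) = (\<integral>\<^sup>+x. F (f (z + x)) * g (f (z + x) - y) \<partial>lborel)"
        by (rule nn_integral_lborel_translation[symmetric]) measurable
      also have "\<dots> = (\<integral>\<^sup>+x. F (y + f x) * g x \<partial>lborel)"
        by (simp add: z linear_add[OF lin] g[OF orthogonal_transformation_norm[OF f]])
      finally show "(\<integral>\<^sup>+x. F (f x) * g (f x - y) \<partial>lborel) = \<dots>" .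
    qed
    also have "\<dots> = (\<integral>\<^sup>+x. \<integral>\<^sup>+y. F (y + f x) * g x \<partial>lborel \<partial>lborel)"
      by (rule lborel_pair.Fubini') measurable
    also have "\<dots> = (\<integral>\<^sup>+x. (\<integral>\<^sup>+y. F y \<partial>lborel) * g x \<partial>lborel)"
    proof (rule nn_integral_cong)
      fix x
      have "(\<integral>\<^sup>+y. F (y + f x) * g x \<partial>lborel) = (\<integral>\<^sup>+y. F (f x + y) \<partial>lborel) * g x"
        by (simp add: add.commute nn_integral_multc)
      then show "(\<integral>\<^sup>+y. F (y + f x) * g x \<partial>lborel) = (\<integral>\<^sup>+y. F y \<partial>lborel) * g x"
        by (simp add: nn_integral_lborel_translation)
    qed
    also have "\<dots> = (\<integral>\<^sup>+x. F x \<partial>lborel) * V"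
      by (simp add: V_def nn_integral_cmult)
    finally show ?thesis .
  qed
  ultimately show ?thesis
    using ennreal_mult_cancel_left[of V] by (simp add: mult.commute)
qed

lemma lborel_distr_orthogonal:
  fixes f :: "'a::euclidean_space \<Rightarrow> 'a"
  assumes f: "orthogonal_transformation f"
  shows "f \<in> borel_measurable borel" "distr lborel borel f = lborel"
proof -
  show [measurable]: "f \<in> borel_measurable borel"
    by (intro borel_measurable_continuous_onI continuous_on_orthogonal_transformation f)
  show "distr lborel borel f = lborel"
  proof (rule measure_eqI)
    fix A assume "A \<in> sets (distr lborel borel f)"
    then have [measurable]: "A \<in> sets borel" by simp
    have "emeasure (distr lborel borel f) A = (\<integral>\<^sup>+x. indicator A x \<partial>distr lborel borel f)"
      by simp
    also have "\<dots> = (\<integral>\<^sup>+x. indicator A (f x) \<partial>lborel)"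
      by (subst nn_integral_distr) simp_all
    also have "\<dots> = (\<integral>\<^sup>+x. indicator A x \<partial>lborel)"
      by (rule nn_integral_lborel_orthogonal[OF f]) measurable
    finally show "emeasure (distr lborel borel f) A = emeasure lborel A" by simp
  qed simp
qed

section \<open>Substitution rules and products for Bochner integrals\<close>

lemma integral_lborel_orthogonal:
  fixes f :: "'a::euclidean_space \<Rightarrow> 'a" and F :: "'a \<Rightarrow> 'b::{banach, second_countable_topology}"
  assumes f: "orthogonal_transformation f" and [measurable]: "F \<in> borel_measurable borel"
  shows "(LINT x|lborel. F (f x)) = (LINT x|lborel. F x)"
proof -
  note [measurable] = lborel_distr_orthogonal(1)[OF f]
  have "(LINT x|distr lborel borel f. F x) = (LINT x|lborel. F (f x))"
    by (rule integral_distr) measurable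
  then show ?thesis by (simp add: lborel_distr_orthogonal(2)[OF f])
qed

lemma has_bochner_integral_lborel_translation:
  fixes F :: "'a::euclidean_space \<Rightarrow> 'b::{banach, second_countable_topology}"
  assumes "has_bochner_integral lborel F I"
  shows "has_bochner_integral lborel (\<lambda>x. F (a + x)) I"
proof -
  have [measurable]: "F \<in> borel_measurable borel"
    using borel_measurable_has_bochner_integral[OF assms] by simp
  show ?thesis
    using assms integrable_distr_eq[of "(+) a" lborel borel F] integral_distr[of "(+) a" lborel borel F]
    by (simp add: has_bochner_integral_iff lborel_distr_plus)
qed

lemma has_bochner_integral_lborel_reflection:
  fixes F :: "'a::euclidean_space \<Rightarrow> 'b::{banach, second_countable_topology}"
  assumes "has_bochner_integral lborel F I"
  shows "has_bochner_integral lborel (\<lambda>x. F (a - x)) I"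
proof -
  have [measurable]: "F \<in> borel_measurable borel"
    using borel_measurable_has_bochner_integral[OF assms] by simp
  have "orthogonal_transformation (\<lambda>x::'a. - x)"
    by (simp add: orthogonal_transformation_neg)
  note lborel_distr_orthogonal(2)[OF this]
  then have "has_bochner_integral lborel (\<lambda>x. F (- x)) I"
    using assms integrable_distr_eq[of uminus lborel borel F] integral_distr[of uminus lborel borel F]
    by (simp add: has_bochner_integral_iff)
  from has_bochner_integral_lborel_translation[OF this, of "- a"] show ?thesis by simp
qed

text \<open>By \<open>lborel_eq\<close>, Lebesgue measure is the image of a product of
  one-dimensional measures under \<open>?\<phi>\<close>, so a product of functions of single
  coordinates integrates factor by factor. This reduces the Gaussian on Euclidean space to the
  line.\<close>

lemma has_bochner_integral_lborel_prod:
  fixes f :: "'a::euclidean_space \<Rightarrow> real \<Rightarrow> 'b::{real_normed_field,banach,second_countable_topology}"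
  assumes "\<And>b. b \<in> Basis \<Longrightarrow> has_bochner_integral lborel (f b) (I b)"
  shows "has_bochner_integral lborel (\<lambda>x::'a. \<Prod>b\<in>Basis. f b (x \<bullet> b)) (\<Prod>b\<in>Basis. I b)"
proof -
  interpret P: product_sigma_finite "\<lambda>_::'a. lborel :: real measure" ..
  have int: "integrable lborel (f b)" "integral\<^sup>L lborel (f b) = I b" if "b \<in> Basis" for b
    using assms[OF that] by (auto simp: has_bochner_integral_iff)
  have [measurable]: "f b \<in> borel_measurable borel" if "b \<in> Basis" for b
    using borel_measurable_integrable[OF int(1)[OF that]] by simp
  let ?\<phi> = "\<lambda>g :: 'a \<Rightarrow> real. \<Sum>b\<in>Basis. g b *\<^sub>R b"
  let ?F = "\<lambda>x::'a. \<Prod>b\<in>Basis. f b (x \<bullet> b)"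
  have \<phi>: "?\<phi> \<in> measurable (\<Pi>\<^sub>M b\<in>Basis. lborel) borel"
    by measurable
  have F: "?F \<in> borel_measurable borel"
    by measurable
  have eq: "?F (?\<phi> g) = (\<Prod>b\<in>Basis. f b (g b))" for g
    by simp
  have "integrable (distr (\<Pi>\<^sub>M b\<in>Basis. lborel) borel ?\<phi>) ?F"
    unfolding integrable_distr_eq[OF \<phi> F] eq by (rule P.product_integrable_prod) (simp_all add: int)
  moreover have "integral\<^sup>L (distr (\<Pi>\<^sub>M b\<in>Basis. lborel) borel ?\<phi>) ?F = (\<Prod>b\<in>Basis. I b)"
    unfolding integral_distr[OF \<phi> F] eq
    by (subst P.product_integral_prod) (simp_all add: int)
  ultimately show ?thesis
    by (simp add: has_bochner_integral_iff lborel_eq[symmetric])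
qed

section \<open>The complex Gaussian kernel\<close>

text \<open>The right-hand side is the central binomial coefficient over \<open>4 ^ n\<close>, the
  \<open>n\<close>-th Taylor coefficient of \<open>(1 - z) powr (- 1 / 2)\<close> at 0. In this form
  it can be compared with the even normal moments.\<close>

lemma gbinomial_neg_half:
  "((- 1 / 2 :: complex) gchoose n) * (-1) ^ n = fact (2 * n) / (4 ^ n * fact n ^ 2)"
proof (induction n)
  case (Suc n)
  have "of_nat (Suc n) * ((- 1 / 2 :: complex) gchoose Suc n) = (- 1 / 2 - of_nat n) * ((- 1 / 2) gchoose n)"
    using gbinomial_mult_1[of "- 1 / 2 :: complex" n] by (simp add: algebra_simps)
  moreover have "- 1 / 2 - of_nat n = - (1 / 2 + of_nat n :: complex)" by simp
  ultimately have "((- 1 / 2 :: complex) gchoose Suc n) = - (1 / 2 + of_nat n) * ((- 1 / 2) gchoose n) / of_nat (Suc n)"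
    by (simp only: eq_divide_eq mult.commute[of "of_nat (Suc n)"] of_nat_eq_0_iff) simp
  moreover have *: "- a * y / m * (-1) ^ Suc n = a / m * (y * (-1) ^ n)" for a y m :: complex
    by simp
  ultimately have "((- 1 / 2 :: complex) gchoose Suc n) * (-1) ^ Suc n
      = (1 / 2 + of_nat n) / of_nat (Suc n) * (((- 1 / 2) gchoose n) * (-1) ^ n)"
    by (simp only: *)
  also have "\<dots> = (1 / 2 + of_nat n) / of_nat (Suc n) * (fact (2 * n) / (4 ^ n * fact n ^ 2))"
    by (simp only: Suc)
  also have "\<dots> = fact (2 * Suc n) / (4 ^ Suc n * fact (Suc n) ^ 2)"
  proof -
    \<comment> \<open>With \<open>m = n + 1\<close> the new factors of the factorial are
      \<open>2 * m\<close> and \<open>2 * m - 1\<close>, and \<open>1 / 2 + n\<close> is half of the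
      latter; a rational identity in \<open>m\<close> remains.\<close>
    define m :: complex where "m = of_nat (Suc n)"
    have m: "m \<noteq> 0" unfolding m_def by (simp del: of_nat_Suc)
    have f2: "fact (2 * Suc n) = (2 * m) * (2 * m - 1) * (fact (2 * n) :: complex)"
      by (simp add: m_def algebra_simps)
    have f1: "fact (Suc n) = m * (fact n :: complex)"
      by (simp add: m_def)
    have n: "of_nat n = m - 1" by (simp add: m_def)
    show ?thesis
      unfolding f2 f1 n m_def[symmetric] using m by (simp add: field_simps power2_eq_square)
  qed
  finally show ?case .
qed simp

text \<open>Expand the factor \<open>exp (w * x\<^sup>2 / 2)\<close> and integrate the series term by term.\<close>

lemma has_bochner_integral_gaussian_disc:
  fixes w :: complex
  assumes w: "norm w < 1"
  shows "has_bochner_integral lborel (\<lambda>x. exp (- (1 - w) * of_real (x\<^sup>2) / 2))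
    (of_real (sqrt (2 * pi)) * (1 - w) powr (- 1 / 2))"
proof -
  define \<alpha> :: "nat \<Rightarrow> real" where "\<alpha> n = fact (2 * n) / (4 ^ n * fact n ^ 2)" for n
  have \<alpha>: "(\<lambda>n. of_real (\<alpha> n) * z ^ n) sums (1 - z) powr (- 1 / 2)" if "norm z < 1" for z :: complex
  proof -
    have "of_real (\<alpha> n) * z ^ n = ((- 1 / 2) gchoose n) * (- z) ^ n" for n
      using gbinomial_neg_half[of n] by (simp add: \<alpha>_def power_minus[of z] mult_ac)
    then show ?thesis
      using gen_binomial_complex[of "- z" "- 1 / 2"] that by simp
  qed
  have \<alpha>_nonneg: "\<alpha> n \<ge> 0" for n by (simp add: \<alpha>_def)
  \<comment> \<open>The \<open>n\<close>-th term of the expansion, weighted with the standard normal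
    density. The \<open>2 * n\<close>-th moment is \<open>2 ^ n * fact n * \<alpha> n\<close>, so
    \<open>f n\<close> integrates to exactly \<open>\<alpha> n * w ^ n\<close>.\<close>
  define f :: "nat \<Rightarrow> real \<Rightarrow> complex" where
    "f n x = of_real (std_normal_density x * x ^ (2 * n)) * (w ^ n / (2 ^ n * fact n))" for n x
  define I where "I = (1 - w) powr (- 1 / 2)"
  have moment: "has_bochner_integral lborel (\<lambda>x. std_normal_density x * x ^ (2 * n)) (2 ^ n * fact n * \<alpha> n)" for n
  proof -
    have "fact (2 * n) / (2 ^ n * fact n) = 2 ^ n * fact n * \<alpha> n"
      by (simp add: \<alpha>_def field_simps power2_eq_square power_mult_distrib[symmetric])
    then show ?thesis using std_normal_moment_even[of n] by simp
  qed
  have f: "has_bochner_integral lborel (f n) (of_real (\<alpha> n) * w ^ n)" for n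
  proof -
    have "has_bochner_integral lborel (\<lambda>x. of_real (std_normal_density x * x ^ (2 * n)) * (w ^ n / (2 ^ n * fact n)))
        (of_real (2 ^ n * fact n * \<alpha> n) * (w ^ n / (2 ^ n * fact n)))"
      by (intro has_bochner_integral_mult_left has_bochner_integral_of_real moment)
    then show ?thesis by (simp add: f_def[abs_def])
  qed
  have norm_f: "has_bochner_integral lborel (\<lambda>x. norm (f n x)) (\<alpha> n * norm w ^ n)" for n
  proof -
    have "has_bochner_integral lborel (\<lambda>x. std_normal_density x * x ^ (2 * n) * (norm w ^ n / (2 ^ n * fact n)))
        (2 ^ n * fact n * \<alpha> n * (norm w ^ n / (2 ^ n * fact n)))"
      by (intro has_bochner_integral_mult_left moment)
    then show ?thesis
      by (simp add: f_def norm_mult norm_divide norm_power power_mult power2_eq_square)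
  qed
  have sums_f: "(\<lambda>n. f n x) sums (of_real (std_normal_density x) * exp (w * of_real (x\<^sup>2) / 2))" for x
  proof -
    have p: "(w * of_real (x\<^sup>2) / 2) ^ n = of_real (x ^ (2 * n)) * w ^ n / 2 ^ n" for n
      by (simp add: power_divide power_mult_distrib power_mult)
    have "f n x = of_real (std_normal_density x) * ((w * of_real (x\<^sup>2) / 2) ^ n /\<^sub>R fact n)" for n
      unfolding f_def p by (simp add: scaleR_conv_of_real divide_simps)
    then show ?thesis
      by (simp only: sums_mult[OF exp_converges])
  qed
  \<comment> \<open>The integrals of the norms form the same binomial series at the point
    \<open>norm w\<close>, which lies inside the disc of convergence. This justifies the termwise
    integration.\<close>
  have sum_norm: "summable (\<lambda>n. \<alpha> n * norm w ^ n)"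
  proof -
    have "summable (\<lambda>n. of_real (\<alpha> n) * of_real (norm w) ^ n :: complex)"
      using \<alpha>[of "of_real (norm w)"] w by (intro sums_summable) simp
    then have "summable (\<lambda>n. complex_of_real (\<alpha> n * norm w ^ n))" by simp
    then show ?thesis by (simp only: summable_complex_of_real)
  qed
  have AE: "AE x in lborel. summable (\<lambda>n. norm (f n x))"
  proof (rule AE_I2)
    fix x
    have p: "(norm w * x\<^sup>2 / 2) ^ n = x ^ (2 * n) * norm w ^ n / 2 ^ n" for n
      by (simp add: power_divide power_mult_distrib power_mult)
    have "norm (f n x) = std_normal_density x * ((norm w * x\<^sup>2 / 2) ^ n /\<^sub>R fact n)" for n
      unfolding f_def p by (simp add: norm_mult norm_divide norm_power power_mult divide_simps)
    then show "summable (\<lambda>n. norm (f n x))"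
      by (simp only: summable_mult[OF summable_exp_generic])
  qed
  have int: "integrable lborel (f n)" "integral\<^sup>L lborel (f n) = of_real (\<alpha> n) * w ^ n"
    "(LINT x|lborel. norm (f n x)) = \<alpha> n * norm w ^ n" for n
    using f[of n] norm_f[of n] by (auto simp: has_bochner_integral_iff)
  have sum: "summable (\<lambda>n. LINT x|lborel. norm (f n x))"
    using sum_norm by (simp only: int)
  have sumf: "(\<Sum>n. f n x) = of_real (std_normal_density x) * exp (w * of_real (x\<^sup>2) / 2)" for x
    using sums_f by (rule sums_unique[symmetric])
  have "(\<lambda>n. of_real (\<alpha> n) * w ^ n) sums (LINT x|lborel. (\<Sum>n. f n x))"
    using sums_integral[OF int(1) AE sum] by (simp only: int)
  then have "(LINT x|lborel. (\<Sum>n. f n x)) = I"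
    using \<alpha>[OF w] sums_unique2 unfolding I_def by blast
  then have "has_bochner_integral lborel
      (\<lambda>x. of_real (std_normal_density x) * exp (w * of_real (x\<^sup>2) / 2)) I"
    using integrable_suminf[OF int(1) AE sum] by (simp add: has_bochner_integral_iff sumf)
  from has_bochner_integral_mult_right[OF this, of "of_real (sqrt (2 * pi))"]
  show ?thesis
  proof (rule has_bochner_integral_cong[THEN iffD1, rotated -1])
    fix x :: real
    show "of_real (sqrt (2 * pi)) * (of_real (std_normal_density x) * exp (w * of_real (x\<^sup>2) / 2)) =
        exp (- (1 - w) * of_real (x\<^sup>2) / 2)"
      by (simp add: std_normal_density_def exp_of_real[symmetric] exp_add[symmetric] ring_distribs diff_divide_distrib)
  qed (simp_all add: I_def)
qed

text \<open>Every \<open>c\<close> in the right half-plane is a positive multiple of a point of the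
  disc of radius 1 around 1; the multiple is absorbed by the substitution of
  \<open>sqrt r * x\<close> for \<open>x\<close>.\<close>

lemma has_bochner_integral_gaussian:
  fixes c :: complex
  assumes c: "Re c > 0"
  shows "has_bochner_integral lborel (\<lambda>x. exp (- c * of_real (x\<^sup>2) / 2))
    (of_real (sqrt (2 * pi)) * c powr (- 1 / 2))"
proof -
  \<comment> \<open>\<open>1 / r\<close> is the real \<open>u\<close> that minimizes
    \<open>norm (1 - u * c)\<close>.\<close>
  define r where "r = (norm c)\<^sup>2 / Re c"
  have "c \<noteq> 0" using c by auto
  then have r: "r > 0" using c by (simp add: r_def)
  define w where "w = 1 - c / of_real r"
  have "(norm w)\<^sup>2 = 1 - (Re c)\<^sup>2 / (norm c)\<^sup>2"
  proof -
    have n: "(norm c)\<^sup>2 = Re c ^ 2 + Im c ^ 2" by (simp add: cmod_power2)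
    have "(norm w)\<^sup>2 = 1 - 2 * Re c / r + (Re c ^ 2 + Im c ^ 2) / r\<^sup>2"
      by (simp add: w_def cmod_power2 power2_diff power_divide add_divide_distrib)
    also have "\<dots> = 1 - 2 * Re c / r + Re c * (r / r\<^sup>2)"
      using c by (simp add: n[symmetric] r_def)
    also have "\<dots> = 1 - Re c / r"
      using r by (simp add: field_simps power2_eq_square)
    finally show ?thesis by (simp add: r_def power2_eq_square)
  qed
  also have "\<dots> < 1" using c \<open>c \<noteq> 0\<close> by simp
  finally have w: "norm w < 1" by (simp add: power_less_one_iff)
  have *: "1 - w = c / of_real r" by (simp add: w_def)
  have "has_bochner_integral lborel (\<lambda>x. exp (- (c / of_real r) * of_real ((0 + sqrt r * x)\<^sup>2) / 2))
     (of_real (sqrt (2 * pi)) * (c / of_real r) powr (- 1 / 2) /\<^sub>R sqrt r)"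
    using lborel_has_bochner_integral_real_affine_iff[THEN iffD1,
        OF _ has_bochner_integral_gaussian_disc[OF w, unfolded *], of "sqrt r" 0] r by simp
  moreover have "of_real (sqrt (2 * pi)) * (c / of_real r) powr (- 1 / 2) /\<^sub>R sqrt r =
      of_real (sqrt (2 * pi)) * c powr (- 1 / 2)"
  proof -
    have "exp (ln r / 2) = sqrt r"
      using r by (simp add: ln_sqrt[symmetric] exp_ln)
    then have "exp (of_real (ln r) / 2) = complex_of_real (sqrt r)"
      by (metis exp_of_real of_real_divide of_real_numeral)
    \<comment> \<open>Division by a positive real leaves the argument of \<open>c\<close> unchanged,
      so the principal branch just splits off \<open>ln r\<close>.\<close>
    moreover have "(c / of_real r) powr (- 1 / 2) = exp (- 1 / 2 * Ln c + of_real (ln r) / 2)"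
      using r \<open>c \<noteq> 0\<close> by (simp add: powr_def Ln_divide_of_real right_diff_distrib)
    ultimately have "(c / of_real r) powr (- 1 / 2) = c powr (- 1 / 2) * of_real (sqrt r)"
      using \<open>c \<noteq> 0\<close> by (simp only: exp_add) (simp add: powr_def)
    then show ?thesis
      using r by (simp add: scaleR_conv_of_real)
  qed
  moreover have "- (c / of_real r) * of_real ((0 + sqrt r * x)\<^sup>2) = - c * of_real (x\<^sup>2)" for x
    using r by (simp add: power_mult_distrib)
  ultimately show ?thesis
    by (simp only:)
qed


text \<open>For real \<open>z > 0\<close> this is the heat kernel at time \<open>z\<close>, that is,
  the normal density with variance \<open>2 * z\<close> in each coordinate. The power is written
  with \<open>Ln\<close> in the form that \<open>mat_neg_half_power\<close> produces.\<close>

definition gauss_kernel :: "complex \<Rightarrow> 'a::euclidean_space \<Rightarrow> complex" where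
  "gauss_kernel z y =
    exp (- (of_nat DIM('a) / 2) * Ln (4 * of_real pi * z)) * exp (- of_real ((norm y)\<^sup>2) / (4 * z))"

lemma gauss_kernel_radial:
  fixes x y :: "'a::euclidean_space"
  shows "norm x = norm y \<Longrightarrow> gauss_kernel z x = gauss_kernel z y"
  by (simp add: gauss_kernel_def)

text \<open>With \<open>c = inverse (2 * z)\<close> the exponential is a product over the
  coordinates of Gaussians with the same integral \<open>J\<close>. Since
  \<open>J = exp (L / 2)\<close>, the product of the integrals cancels the normalizing factor for
  the same \<open>L\<close>.\<close>

lemma has_bochner_integral_gauss_kernel:
  assumes z: "Re z > 0"
  shows "has_bochner_integral lborel (gauss_kernel z :: 'a::euclidean_space \<Rightarrow> complex) 1"
proof -
  have "z \<noteq> 0" using z by auto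
  define c where "c = inverse (2 * z)"
  define J where "J = of_real (sqrt (2 * pi)) * c powr (- 1 / 2)"
  define L where "L = Ln (4 * of_real pi * z)"
  have c: "Re c > 0"
    using z \<open>z \<noteq> 0\<close> by (simp add: c_def Re_divide cmod_power2[symmetric])
  \<comment> \<open>The branches agree because \<open>2 * z\<close> avoids the closed negative
    half-line, where \<open>Ln_inverse\<close> would fail, and the positive factor
    \<open>2 * pi\<close> only adds a real logarithm.\<close>
  have J: "J = exp (L / 2)"
  proof -
    have "2 * z \<notin> \<real>\<^sub>\<le>\<^sub>0"
      using z by (auto simp: complex_nonpos_Reals_iff)
    then have "Ln c = - Ln (2 * z)"
      unfolding c_def by (rule Ln_inverse)
    moreover have "c \<noteq> 0" using c by auto
    ultimately have 1: "c powr (- 1 / 2) = exp (Ln (2 * z) / 2)"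
      by (simp add: powr_def)
    have "L = of_real (ln (2 * pi)) + Ln (2 * z)"
      using Ln_times_of_real[of "2 * pi" "2 * z"] Ln_of_real[of "2 * pi"] \<open>z \<noteq> 0\<close> by (simp add: L_def mult_ac)
    then have 2: "L / 2 = of_real (ln (2 * pi) / 2) + Ln (2 * z) / 2"
      by (simp add: add_divide_distrib)
    have 3: "exp (ln (2 * pi) / 2) = sqrt (2 * pi)"
      by (subst ln_sqrt[symmetric]) (simp_all add: exp_ln)
    show ?thesis
      unfolding J_def 1 2 exp_add exp_of_real 3 ..
  qed
  have "has_bochner_integral lborel
      (\<lambda>x::'a. \<Prod>b\<in>Basis. exp (- c * of_real ((x \<bullet> b)\<^sup>2) / 2)) (\<Prod>b\<in>(Basis::'a set). J)"
    unfolding J_def by (intro has_bochner_integral_lborel_prod has_bochner_integral_gaussian c)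
  moreover have "(\<Prod>b\<in>Basis. exp (- c * of_real ((x \<bullet> b)\<^sup>2) / 2)) =
      exp (- of_real ((norm x)\<^sup>2) / (4 * z))" for x :: 'a
  proof -
    have "(norm x)\<^sup>2 = (\<Sum>b\<in>Basis. (x \<bullet> b)\<^sup>2)"
      by (subst euclidean_inner[of x x, folded power2_norm_eq_inner]) (simp add: power2_eq_square)
    then have n: "complex_of_real ((norm x)\<^sup>2) = (\<Sum>b\<in>Basis. of_real ((x \<bullet> b)\<^sup>2))"
      by simp
    have "(\<Prod>b\<in>Basis. exp (- c * of_real ((x \<bullet> b)\<^sup>2) / 2)) = exp (\<Sum>b\<in>Basis. - c * of_real ((x \<bullet> b)\<^sup>2) / 2)"
      by (simp add: exp_sum)
    also have "(\<Sum>b\<in>Basis. - c * of_real ((x \<bullet> b)\<^sup>2) / 2) = - c / 2 * of_real ((norm x)\<^sup>2)"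
      unfolding n by (simp add: sum_distrib_left)
    also have "\<dots> = - of_real ((norm x)\<^sup>2) / (4 * z)"
      using \<open>z \<noteq> 0\<close> by (simp add: c_def field_simps)
    finally show ?thesis .
  qed
  moreover have "(\<Prod>b\<in>(Basis::'a set). J) = exp (of_nat DIM('a) / 2 * L)"
    by (simp add: J exp_of_nat_mult[symmetric])
  ultimately have "has_bochner_integral lborel (\<lambda>x::'a. exp (- of_real ((norm x)\<^sup>2) / (4 * z)))
      (exp (of_nat DIM('a) / 2 * L))"
    by simp
  then have "has_bochner_integral lborel
      (\<lambda>x::'a. exp (- (of_nat DIM('a) / 2) * L) * exp (- of_real ((norm x)\<^sup>2) / (4 * z)))
      (exp (- (of_nat DIM('a) / 2) * L) * exp (of_nat DIM('a) / 2 * L))"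
    by (rule has_bochner_integral_mult_right)
  moreover have "exp (- (of_nat DIM('a) / 2) * L) * exp (of_nat DIM('a) / 2 * L) = 1"
    by (simp flip: exp_add)
  ultimately show ?thesis
    by (simp add: gauss_kernel_def[abs_def] L_def)
qed

text \<open>Completing the square. This needs both variances on one ray: otherwise the centre of the
  second Gaussian would not be real.\<close>

lemma gauss_kernel_mult:
  fixes x y :: "'a::euclidean_space"
  assumes a: "a \<noteq> 0" and s: "s > 0" and t: "t > 0"
  shows "gauss_kernel (of_real s * a) (x - y) * gauss_kernel (of_real t * a) y =
    gauss_kernel (of_real (s + t) * a) x *
    gauss_kernel (of_real (s * t / (s + t)) * a) (y - (t / (s + t)) *\<^sub>R x)"
proof -
  define D :: complex where "D = - (of_nat DIM('a) / 2)"
  \<comment> \<open>\<open>1 / r = 1 / s + 1 / t\<close>: the coefficients of the square of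
    \<open>y\<close> add up.\<close>
  define r where "r = s * t / (s + t)"
  have st: "s + t > 0" and r: "r > 0" using s t by (simp_all add: r_def)
  \<comment> \<open>A positive factor only contributes its real logarithm. The normalizing factors
    then match because \<open>s * t = (s + t) * r\<close>.\<close>
  have Ln: "Ln (4 * of_real pi * (of_real u * a)) = of_real (ln u) + Ln (4 * of_real pi * a)" if "u > 0" for u
    using Ln_times_of_real[OF that, of "4 * of_real pi * a"] Ln_of_real[OF that] a by (simp add: mult_ac)
  have "ln s + ln t = ln (s + t) + ln r"
    using s t st by (simp add: r_def ln_mult ln_div)
  then have lnc: "complex_of_real (ln s) + of_real (ln t) = of_real (ln (s + t)) + of_real (ln r)"
    by (metis of_real_add)
  have "D * (p + L) + D * (q + L) = D * (p + q + 2 * L)" for p q L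
    by (simp add: algebra_simps)
  then have logs: "D * (of_real (ln s) + Ln (4 * of_real pi * a)) + D * (of_real (ln t) + Ln (4 * of_real pi * a)) =
      D * (of_real (ln (s + t)) + Ln (4 * of_real pi * a)) + D * (of_real (ln r) + Ln (4 * of_real pi * a))"
    by (simp only: lnc)
  have real_eq: "(norm (x - y))\<^sup>2 / s + (norm y)\<^sup>2 / t =
      (norm x)\<^sup>2 / (s + t) + (norm (y - (t / (s + t)) *\<^sub>R x))\<^sup>2 / r"
  proof -
    have "(norm (x - y))\<^sup>2 = x \<bullet> x - 2 * (x \<bullet> y) + y \<bullet> y"
      by (simp add: power2_norm_eq_inner inner_diff inner_commute)
    moreover have "(norm (y - k *\<^sub>R x))\<^sup>2 = y \<bullet> y - 2 * k * (x \<bullet> y) + k\<^sup>2 * (x \<bullet> x)" for k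
      unfolding power2_norm_eq_inner
      by (simp add: inner_diff inner_commute power2_eq_square algebra_simps)
    moreover have "(X - 2 * Z + W) / s + W / t =
        X / (s + t) + (W - 2 * (t / (s + t)) * Z + (t / (s + t))\<^sup>2 * X) / r" for X Z W :: real
      using s t st unfolding r_def by (simp add: divide_simps power2_eq_square) algebra
    ultimately show ?thesis by (simp only: power2_norm_eq_inner)
  qed
  have quot: "- of_real X / (4 * (of_real u * a)) = - of_real (X / u) / (4 * a)" if "u > 0" for X u
    using that a by (simp add: field_simps)
  have quads: "- of_real ((norm (x - y))\<^sup>2 / s) / (4 * a) + - of_real ((norm y)\<^sup>2 / t) / (4 * a) =
      - of_real ((norm x)\<^sup>2 / (s + t)) / (4 * a) +
      - of_real ((norm (y - (t / (s + t)) *\<^sub>R x))\<^sup>2 / r) / (4 * a)"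
    unfolding add_divide_distrib[symmetric] minus_add_distrib[symmetric] of_real_add[symmetric]
    by (simp only: real_eq)
  have exps: "exp a1 * exp b1 * (exp a2 * exp b2) = exp (a1 + a2) * exp (b1 + b2)" for a1 b1 a2 b2 :: complex
    by (simp add: exp_add)
  show ?thesis
    unfolding gauss_kernel_def r_def[symmetric] D_def[symmetric]
      Ln[OF s] Ln[OF t] Ln[OF st] Ln[OF r] quot[OF s] quot[OF t] quot[OF st] quot[OF r]
      exps logs quads ..
qed

text \<open>After the square is completed, one factor is free of \<open>y\<close> and the other is a
  translate of a Gaussian with integral 1.\<close>

lemma has_bochner_integral_gauss_kernel_conv:
  fixes x :: "'a::euclidean_space"
  assumes a: "Re a > 0" and s: "s > 0" and t: "t > 0"
  shows "has_bochner_integral lborel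
    (\<lambda>y. gauss_kernel (of_real s * a) (x - y) * gauss_kernel (of_real t * a) y)
    (gauss_kernel (of_real (s + t) * a) x)"
proof -
  have "a \<noteq> 0" using a by auto
  have "Re (of_real (s * t / (s + t)) * a) > 0"
    using a s t by simp
  from has_bochner_integral_lborel_translation[OF has_bochner_integral_gauss_kernel[OF this],
      of "- ((t / (s + t)) *\<^sub>R x)", THEN has_bochner_integral_mult_right]
  show ?thesis
    unfolding gauss_kernel_mult[OF \<open>a \<noteq> 0\<close> s t] by simp
qed

section \<open>Convolution with a radial matrix kernel\<close>

lemma C_b_iff: "v \<in> C_b \<longleftrightarrow> continuous_on UNIV v \<and> (\<exists>B. \<forall>x. norm (v x) \<le> B)"
  by (auto simp: C_b_def bcontfun_def bounded_iff)

lemma norm_le_sup_norm: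
  assumes "v \<in> C_b"
  shows "norm (v x) \<le> sup_norm v"
  unfolding sup_norm_def using assms by (intro cSUP_upper) (auto simp: C_b_iff bdd_above_def)

lemma sup_norm_le: "(\<And>x. norm (v x) \<le> B) \<Longrightarrow> sup_norm v \<le> B"
  unfolding sup_norm_def by (intro cSUP_least) auto

lemma matrix_vector_mult_measurable [measurable]:
  fixes H :: "'b \<Rightarrow> complex^'n^'m"
  assumes "H \<in> borel_measurable M" "w \<in> borel_measurable M"
  shows "(\<lambda>x. H x *v w x) \<in> borel_measurable M"
  by (rule borel_measurable_continuous_Pair[OF assms])
     (intro bounded_bilinear.continuous_on[OF bounded_bilinear_matrix_vector_mult] continuous_intros)

text \<open>\<open>K\<close> is the integral of \<open>norm (H y)\<close> times the constant of the
  matrix-vector product. It is chosen before \<open>w\<close> and \<open>B\<close>, so one constant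
  serves all bounded functions.\<close>

lemma integral_kernel_bound:
  fixes H :: "'b \<Rightarrow> complex^'n^'m"
  assumes H: "integrable M H"
  obtains K where "K \<ge> 0"
    "\<And>w B. w \<in> borel_measurable M \<Longrightarrow> (\<And>y. norm (w y) \<le> B) \<Longrightarrow> integrable M (\<lambda>y. H y *v w y)"
    "\<And>w B. w \<in> borel_measurable M \<Longrightarrow> (\<And>y. norm (w y) \<le> B) \<Longrightarrow>
      (LINT y|M. norm (H y *v w y)) \<le> K * B"
proof -
  obtain C where C: "C > 0" "\<And>(X::complex^'n^'m) (v::complex^'n). norm (X *v v) \<le> norm X * norm v * C"
    using bounded_bilinear.pos_bounded[OF bounded_bilinear_matrix_vector_mult] by blast
  note [measurable] = borel_measurable_integrable[OF H]
  have nH: "integrable M (\<lambda>y. norm (H y) * (B * C))" for B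
    using H by (intro integrable_mult_left integrable_norm)
  have le: "norm (H y *v w y) \<le> norm (H y) * (B * C)" if "\<And>y. norm (w y) \<le> B" for w B y
  proof -
    have "norm (H y *v w y) \<le> norm (H y) * (norm (w y) * C)"
      using C(2)[of "H y" "w y"] by (simp add: mult_ac)
    also have "\<dots> \<le> norm (H y) * (B * C)"
      using C(1) that by (intro mult_left_mono mult_right_mono) auto
    finally show ?thesis .
  qed
  have int: "integrable M (\<lambda>y. H y *v w y)"
    if [measurable]: "w \<in> borel_measurable M" and B: "\<And>y. norm (w y) \<le> B" for w B
  proof (rule Bochner_Integration.integrable_bound[OF nH[of B]])
    show "AE y in M. norm (H y *v w y) \<le> norm (norm (H y) * (B * C))"
      using le[of w B, OF B] by (auto intro!: AE_I2 order_trans[OF _ abs_ge_self])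
  qed measurable
  show thesis
  proof (rule that[of "(LINT y|M. norm (H y)) * C"])
    show "(LINT y|M. norm (H y)) * C \<ge> 0"
      using C(1) by simp
    fix w :: "'b \<Rightarrow> complex^'n" and B
    assume w: "w \<in> borel_measurable M" and B: "\<And>y. norm (w y) \<le> B"
    show "integrable M (\<lambda>y. H y *v w y)" using w B by (rule int)
    have "(LINT y|M. norm (H y *v w y)) \<le> (LINT y|M. norm (H y) * (B * C))"
      using int[OF w B] le[of w B, OF B] nH by (intro integral_mono) auto
    then show "(LINT y|M. norm (H y *v w y)) \<le> (LINT y|M. norm (H y)) * C * B"
      by (simp add: mult_ac)
  qed
qed

lemma C_b_comp_measurable:
  fixes v :: "real^'d \<Rightarrow> complex^'n"
  assumes "v \<in> C_b"
  shows "(\<lambda>y. v (a - y)) \<in> borel_measurable borel"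
proof (rule borel_measurable_continuous_onI)
  show "continuous_on UNIV (\<lambda>y. v (a - y))"
    using assms by (intro continuous_on_compose2[of UNIV v UNIV "\<lambda>y. a - y"] continuous_on_diff
        continuous_on_const continuous_on_id) (auto simp: C_b_iff)
qed

text \<open>The integration variable is the displacement \<open>R x - \<xi>\<close>, so
  \<open>x\<close> occurs only in the argument of \<open>v\<close>, and the regularity of
  \<open>v\<close> passes to the image.\<close>

definition kernel_op ::
  "(real^'d \<Rightarrow> complex^'n^'n) \<Rightarrow> (real^'d \<Rightarrow> real^'d) \<Rightarrow> (real^'d \<Rightarrow> complex^'n) \<Rightarrow> real^'d \<Rightarrow> complex^'n" where
  "kernel_op H R v x = (LINT y|lborel. H y *v v (R x - y))"

context
  fixes H :: "real^'d \<Rightarrow> complex^'n^'n"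
  assumes H: "integrable lborel H"
begin

lemma kernel_op_integrable:
  assumes v: "v \<in> C_b"
  shows "integrable lborel (\<lambda>y. H y *v v (a - y))"
proof -
  obtain K where "\<And>w B. w \<in> borel_measurable lborel \<Longrightarrow> (\<And>y. norm (w y) \<le> B) \<Longrightarrow>
      integrable lborel (\<lambda>y. H y *v (w y :: complex^'n))"
    by (rule integral_kernel_bound[OF H]) blast
  from this[of "\<lambda>y. v (a - y)" "sup_norm v"] show ?thesis
    using C_b_comp_measurable[OF v] norm_le_sup_norm[OF v] by simp
qed

text \<open>The last clause compares two functions at two centres. It is used with
  \<open>v = 0\<close> for boundedness, with \<open>u = v\<close> for uniform continuity, and with a
  rotated copy of \<open>v\<close> for \<open>C_rub\<close>.\<close>

lemma kernel_op_bound: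
  obtains K where "K \<ge> 0"
    "\<And>v. v \<in> C_b \<Longrightarrow> sup_norm (kernel_op H R v) \<le> K * sup_norm v"
    "\<And>u v a b B. u \<in> C_b \<Longrightarrow> v \<in> C_b \<Longrightarrow> (\<And>y. norm (u (a - y) - v (b - y)) \<le> B) \<Longrightarrow>
       norm ((LINT y|lborel. H y *v u (a - y)) - (LINT y|lborel. H y *v v (b - y))) \<le> K * B"
proof -
  obtain K where K: "K \<ge> 0" "\<And>w B. w \<in> borel_measurable lborel \<Longrightarrow> (\<And>y. norm (w y) \<le> B) \<Longrightarrow>
      (LINT y|lborel. norm (H y *v (w y :: complex^'n))) \<le> K * B"
    by (rule integral_kernel_bound[OF H]) blast
  show thesis
  proof (rule that[OF K(1)])
    fix v :: "real^'d \<Rightarrow> complex^'n" assume v: "v \<in> C_b"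
    show "sup_norm (kernel_op H R v) \<le> K * sup_norm v"
    proof (rule sup_norm_le)
      fix x
      have "norm (kernel_op H R v x) \<le> (LINT y|lborel. norm (H y *v v (R x - y)))"
        unfolding kernel_op_def by (rule integral_norm_bound)
      also have "\<dots> \<le> K * sup_norm v"
        using C_b_comp_measurable[OF v] norm_le_sup_norm[OF v] by (intro K(2)) simp_all
      finally show "norm (kernel_op H R v x) \<le> K * sup_norm v" .
    qed
  next
    fix u v :: "real^'d \<Rightarrow> complex^'n" and a b B
    assume u: "u \<in> C_b" and v: "v \<in> C_b" and B: "\<And>y. norm (u (a - y) - v (b - y)) \<le> B"
    have "(LINT y|lborel. H y *v u (a - y)) - (LINT y|lborel. H y *v v (b - y)) =
        (LINT y|lborel. H y *v (u (a - y) - v (b - y)))"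
      by (simp add: matrix_vector_mult_diff_distrib kernel_op_integrable u v)
    also have "norm \<dots> \<le> (LINT y|lborel. norm (H y *v (u (a - y) - v (b - y))))"
      by (rule integral_norm_bound)
    also have "\<dots> \<le> K * B"
      using C_b_comp_measurable[OF v] C_b_comp_measurable[OF u] B by (intro K(2)) simp_all
    finally show "norm ((LINT y|lborel. H y *v u (a - y)) - (LINT y|lborel. H y *v v (b - y))) \<le> K * B" .
  qed
qed

context
  fixes R :: "real^'d \<Rightarrow> real^'d"
  assumes R: "orthogonal_transformation R"
begin

text \<open>Continuity is dominated convergence along sequences, with a multiple of
  \<open>norm (H y)\<close> as majorant; boundedness is the comparison with the zero
  function.\<close>

lemma kernel_op_C_b:
  assumes v: "v \<in> C_b"
  shows "kernel_op H R v \<in> C_b"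
proof -
  obtain C where C: "C > 0" "\<And>(X::complex^'n^'n) (v::complex^'n). norm (X *v v) \<le> norm X * norm v * C"
    using bounded_bilinear.pos_bounded[OF bounded_bilinear_matrix_vector_mult] by blast
  note [measurable] = borel_measurable_integrable[OF H] C_b_comp_measurable[OF v]
  have "continuous_on UNIV (kernel_op H R v)"
  proof (rule continuous_on_sequentiallyI)
    fix u :: "nat \<Rightarrow> real^'d" and a
    assume u: "u \<longlonglongrightarrow> a"
    have "(\<lambda>n. LINT y|lborel. H y *v v (R (u n) - y)) \<longlonglongrightarrow> (LINT y|lborel. H y *v v (R a - y))"
    proof (rule integral_dominated_convergence[where w = "\<lambda>y. norm (H y) * (sup_norm v * C)"])
      show "integrable lborel (\<lambda>y. norm (H y) * (sup_norm v * C))"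
        using H by (intro integrable_mult_left integrable_norm)
      have "(\<lambda>n. R (u n) - y) \<longlonglongrightarrow> R a - y" for y
        using continuous_on_tendsto_compose[OF continuous_on_orthogonal_transformation[OF R, of UNIV] u] by (intro tendsto_intros) auto
      then have "(\<lambda>n. v (R (u n) - y)) \<longlonglongrightarrow> v (R a - y)" for y
        using v continuous_on_tendsto_compose[of UNIV v] by (auto simp: C_b_iff)
      then show "AE y in lborel. (\<lambda>n. H y *v v (R (u n) - y)) \<longlonglongrightarrow> H y *v v (R a - y)"
        by (intro AE_I2 bounded_bilinear.tendsto[OF bounded_bilinear_matrix_vector_mult] tendsto_const)
      show "AE y in lborel. norm (H y *v v (R (u n) - y)) \<le> norm (H y) * (sup_norm v * C)" for n
      proof (rule AE_I2)
        fix y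
        have "norm (H y *v v (R (u n) - y)) \<le> norm (H y) * (norm (v (R (u n) - y)) * C)"
          using C(2)[of "H y" "v (R (u n) - y)"] by (simp add: mult_ac)
        also have "\<dots> \<le> norm (H y) * (sup_norm v * C)"
          using C(1) norm_le_sup_norm[OF v] by (intro mult_left_mono mult_right_mono) auto
        finally show "norm (H y *v v (R (u n) - y)) \<le> norm (H y) * (sup_norm v * C)" .
      qed
    qed measurable
    then show "(\<lambda>n. kernel_op H R v (u n)) \<longlonglongrightarrow> kernel_op H R v a"
      by (simp add: kernel_op_def)
  qed
  moreover obtain K where "K \<ge> 0"
    "norm ((LINT y|lborel. H y *v v (R x - y)) - (LINT y|lborel. H y *v 0)) \<le> K * sup_norm v" for x
  proof (rule kernel_op_bound)
    fix K :: real
    assume *: "K \<ge> 0" and "\<And>u v a b B. u \<in> C_b \<Longrightarrow> v \<in> C_b \<Longrightarrow> (\<And>y. norm (u (a - y) - v (b - y)) \<le> B) \<Longrightarrow>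
       norm ((LINT y|lborel. H y *v u (a - y)) - (LINT y|lborel. H y *v v (b - y))) \<le> K * B"
    from this(2)[of v "\<lambda>_. 0"] show thesis
      using that[OF *] v norm_le_sup_norm[OF v] by (auto simp: C_b_iff)
  qed
  ultimately show ?thesis
    by (auto simp: C_b_iff kernel_op_def)
qed

text \<open>As \<open>R\<close> is an isometry, \<open>R x' - y\<close> and \<open>R x - y\<close>
  are as far apart as \<open>x'\<close> and \<open>x\<close> for every \<open>y\<close>, so the
  modulus of continuity of \<open>v\<close> applies under the integral.\<close>

lemma kernel_op_C_ub:
  assumes v: "v \<in> C_ub"
  shows "kernel_op H R v \<in> C_ub"
proof -
  have vb: "v \<in> C_b" and vu: "uniformly_continuous_on UNIV v"
    using v by (auto simp: C_ub_def)
  obtain K where K: "K \<ge> 0"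
    "\<And>u v a b B. u \<in> C_b \<Longrightarrow> v \<in> C_b \<Longrightarrow> (\<And>y. norm (u (a - y) - v (b - y)) \<le> B) \<Longrightarrow>
       norm ((LINT y|lborel. H y *v u (a - y)) - (LINT y|lborel. H y *v v (b - y))) \<le> K * B"
    by (rule kernel_op_bound) blast
  have "uniformly_continuous_on UNIV (kernel_op H R v)"
    unfolding uniformly_continuous_on_def
  proof (intro allI impI)
    fix e :: real assume "e > 0"
    \<comment> \<open>\<open>K\<close> may be 0; the divisor \<open>K + 1\<close> is positive and
      also makes the final estimate strict.\<close>
    then have "e / (K + 1) > 0" using K(1) by simp
    then obtain d where d: "d > 0" "\<And>x x'. dist x' x < d \<Longrightarrow> dist (v x') (v x) < e / (K + 1)"
      by (rule uniformly_continuous_onE[OF vu]) (use UNIV_I in metis)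
    have "dist (kernel_op H R v x') (kernel_op H R v x) < e" if "dist x' x < d" for x x'
    proof -
      have "dist (R x' - y) (R x - y) = dist x' x" for y
        by (simp add: dist_norm linear_diff[OF orthogonal_transformation_linear[OF R], symmetric] orthogonal_transformation_norm[OF R])
      then have "norm (v (R x' - y) - v (R x - y)) \<le> e / (K + 1)" for y
        using d(2)[of "R x' - y" "R x - y"] that by (simp add: dist_norm less_imp_le)
      then have "dist (kernel_op H R v x') (kernel_op H R v x) \<le> K * (e / (K + 1))"
        unfolding dist_norm kernel_op_def by (intro K(2) vb)
      also have "\<dots> < e"
        using K(1) \<open>e > 0\<close> by (simp add: field_simps)
      finally show ?thesis .
    qed
    then show "\<exists>d>0. \<forall>x\<in>UNIV. \<forall>x'\<in>UNIV. dist x' x < d \<longrightarrow> dist (kernel_op H R v x') (kernel_op H R v x) < e"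
      using d(1) by blast
  qed
  then show ?thesis
    using kernel_op_C_b[OF vb] by (simp add: C_ub_def)
qed

text \<open>A radial kernel commutes with rotations, so the rotational modulus of continuity of the
  image is controlled by that of the function.\<close>

lemma kernel_op_C_rub:
  assumes v: "v \<in> C_rub S" and S: "skew_symmetric S"
    and radial: "\<And>x y. norm x = norm y \<Longrightarrow> H x = H y"
    and comm: "\<And>t x. R (mat_exp (t *\<^sub>R S) *v x) = mat_exp (t *\<^sub>R S) *v R x"
  shows "kernel_op H R v \<in> C_rub S"
proof -
  have vub: "v \<in> C_ub" and vb: "v \<in> C_b"
    and lim: "((\<lambda>t::real. SUP x. norm (v (mat_exp (- t *\<^sub>R S) *v x) - v x)) \<longlongrightarrow> 0) (at 0)"
    using v by (auto simp: C_rub_def C_ub_def)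
  let ?m = "\<lambda>v t. SUP x. norm (v (mat_exp (- t *\<^sub>R S) *v x) - v x :: complex^'n)"
  obtain K where K: "K \<ge> 0"
    "\<And>u v a b B. u \<in> C_b \<Longrightarrow> v \<in> C_b \<Longrightarrow> (\<And>y. norm (u (a - y) - v (b - y)) \<le> B) \<Longrightarrow>
       norm ((LINT y|lborel. H y *v u (a - y)) - (LINT y|lborel. H y *v v (b - y))) \<le> K * B"
    by (rule kernel_op_bound) blast
  have bdd: "bdd_above (range (\<lambda>x. norm (v (mat_exp (- t *\<^sub>R S) *v x) - v x)))" for t
  proof (rule bdd_aboveI2)
    fix x show "norm (v (mat_exp (- t *\<^sub>R S) *v x) - v x) \<le> sup_norm v + sup_norm v"
      by (rule norm_triangle_le_diff) (intro add_mono norm_le_sup_norm vb)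
  qed
  have le: "norm (kernel_op H R v (mat_exp (- t *\<^sub>R S) *v x) - kernel_op H R v x) \<le> K * ?m v t" for t x
  proof -
    define Q where "Q = ((*v) (mat_exp (- t *\<^sub>R S)))"
    have Q: "orthogonal_transformation Q"
      unfolding Q_def using orthogonal_mat_exp_skew[OF S, of "- t"]
      by (simp add: orthogonal_transformation_matrix)
    note [measurable] = borel_measurable_integrable[OF H] C_b_comp_measurable[OF vb]
    have "kernel_op H R v (Q x) = (LINT y|lborel. H y *v v (Q (R x) - y))"
      unfolding kernel_op_def Q_def comm ..
    \<comment> \<open>Substituting \<open>Q y\<close> for \<open>y\<close>, with \<open>H\<close>
      radial and \<open>Q\<close> linear, moves the rotation from the point onto the function
      \<open>v\<close>.\<close>
    also have "\<dots> = (LINT y|lborel. H (Q y) *v v (Q (R x) - Q y))"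
      by (rule integral_lborel_orthogonal[OF Q, symmetric]) measurable
    also have "\<dots> = (LINT y|lborel. H y *v (v \<circ> Q) (R x - y))"
      by (simp add: radial[OF orthogonal_transformation_norm[OF Q]]
          linear_diff[OF orthogonal_transformation_linear[OF Q]])
    finally have "norm (kernel_op H R v (Q x) - kernel_op H R v x) =
        norm ((LINT y|lborel. H y *v (v \<circ> Q) (R x - y)) - (LINT y|lborel. H y *v v (R x - y)))"
      by (simp add: kernel_op_def)
    also have "\<dots> \<le> K * ?m v t"
    proof (rule K(2))
      show "v \<circ> Q \<in> C_b"
        using vb continuous_on_orthogonal_transformation[OF Q]
        by (auto simp: C_b_iff o_def intro: continuous_on_compose2[of UNIV v])
      show "norm ((v \<circ> Q) (R x - y) - v (R x - y)) \<le> ?m v t" for y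
        unfolding Q_def o_def by (rule cSUP_upper[OF UNIV_I bdd])
    qed (rule vb)
    finally show ?thesis by (simp add: Q_def)
  qed
  have "((\<lambda>t. ?m (kernel_op H R v) t) \<longlongrightarrow> 0) (at 0)"
  proof (rule tendsto_sandwich[where f = "\<lambda>_. 0" and h = "\<lambda>t. K * ?m v t"])
    show "((\<lambda>t. K * ?m v t) \<longlongrightarrow> 0) (at 0)"
      using tendsto_mult_left[OF lim, of K] by simp
    show "\<forall>\<^sub>F t in at 0. ?m (kernel_op H R v) t \<le> K * ?m v t"
      by (intro always_eventually allI cSUP_least le) auto
    show "\<forall>\<^sub>F t in at 0. 0 \<le> ?m (kernel_op H R v) t"
    proof (intro always_eventually allI)
      fix t
      \<comment> \<open>A real supremum is meaningful only for a set bounded above, so even its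
        nonnegativity needs this.\<close>
      have "bdd_above (range (\<lambda>x. norm (kernel_op H R v (mat_exp (- t *\<^sub>R S) *v x) - kernel_op H R v x)))"
        using le by (rule bdd_aboveI2)
      then show "0 \<le> ?m (kernel_op H R v) t"
        by (rule cSUP_upper2[OF _ UNIV_I]) simp
    qed
  qed simp
  then show ?thesis
    using kernel_op_C_ub[OF vub] by (simp add: C_rub_def)
qed

end

end

text \<open>The inner operator is evaluated at \<open>R x - y\<close>, and \<open>Q\<close> sends
  this to \<open>a - Q y\<close> with \<open>a = Q (R x)\<close>. The radial \<open>H\<close> lets
  \<open>Q y\<close> be replaced by \<open>y\<close>, and after a shift of \<open>z\<close> Fubini
  produces the convolution of \<open>H\<close> and \<open>G\<close> acting on
  \<open>v\<close>.\<close>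

lemma kernel_op_kernel_op:
  fixes H G P :: "real^'d \<Rightarrow> complex^'n^'n"
  assumes H: "integrable lborel H" and G: "integrable lborel G"
    and R: "orthogonal_transformation R" and Q: "orthogonal_transformation Q"
    and radial: "\<And>x y. norm x = norm y \<Longrightarrow> H x = H y"
    and conv: "\<And>z. has_bochner_integral lborel (\<lambda>y. H y ** G (z - y)) (P z)"
    and v: "v \<in> C_b"
  shows "kernel_op H R (kernel_op G Q v) x = kernel_op P (Q \<circ> R) v x"
proof -
  note [measurable] = borel_measurable_integrable[OF H] borel_measurable_integrable[OF G]
    C_b_comp_measurable[OF v]
  define a where "a = Q (R x)"
  define w where "w z = v (a - z)" for z
  have [measurable]: "w \<in> borel_measurable borel" unfolding w_def by measurable
  have w: "norm (w z) \<le> sup_norm v" for z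
    unfolding w_def using v by (rule norm_le_sup_norm)
  define f where "f y z = H y *v (G (z - y) *v w z)" for y z
  have [measurable]: "case_prod f \<in> borel_measurable (lborel \<Otimes>\<^sub>M lborel)"
    unfolding f_def by measurable
  have Gint: "integrable lborel (\<lambda>z. G (z - y))" for y
    using has_bochner_integral_lborel_translation[OF has_bochner_integral_integrable[OF G], of "- y"]
    by (simp add: has_bochner_integral_iff)
  obtain C where C: "C > 0" "\<And>(X::complex^'n^'n) (v::complex^'n). norm (X *v v) \<le> norm X * norm v * C"
    using bounded_bilinear.pos_bounded[OF bounded_bilinear_matrix_vector_mult] by blast
  obtain L where L: "L \<ge> 0"
    "\<And>w B. w \<in> borel_measurable lborel \<Longrightarrow> (\<And>y. norm (w y) \<le> B) \<Longrightarrow> integrable lborel (\<lambda>y. G y *v (w y :: complex^'n))"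
    "\<And>w B. w \<in> borel_measurable lborel \<Longrightarrow> (\<And>y. norm (w y) \<le> B) \<Longrightarrow>
      (LINT y|lborel. norm (G y *v (w y :: complex^'n))) \<le> L * B"
    by (rule integral_kernel_bound[OF G]) blast
  have Gw: "has_bochner_integral lborel (\<lambda>z. norm (G (z - y) *v w z)) (LINT z|lborel. norm (G z *v w (y + z)))"
    and Gw': "has_bochner_integral lborel (\<lambda>z. G (z - y) *v w z) (LINT z|lborel. G z *v w (y + z))" for y
  proof -
    have "integrable lborel (\<lambda>z. G z *v w (y + z))"
      by (rule L(2)[OF _ w]) measurable
    then have "has_bochner_integral lborel (\<lambda>z. norm (G z *v w (y + z))) (LINT z|lborel. norm (G z *v w (y + z)))"
      "has_bochner_integral lborel (\<lambda>z. G z *v w (y + z)) (LINT z|lborel. G z *v w (y + z))"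
      by (auto simp: has_bochner_integral_iff)
    from this[THEN has_bochner_integral_lborel_translation, of "- y"]
    show "has_bochner_integral lborel (\<lambda>z. norm (G (z - y) *v w z)) (LINT z|lborel. norm (G z *v w (y + z)))"
      "has_bochner_integral lborel (\<lambda>z. G (z - y) *v w z) (LINT z|lborel. G z *v w (y + z))"
      by simp_all
  qed
  have bl: "bounded_linear ((*v) (X :: complex^'n^'n))" for X
    by (rule bounded_bilinear.bounded_linear_right[OF bounded_bilinear_matrix_vector_mult])
  have fint: "has_bochner_integral lborel (f y) (H y *v (LINT z|lborel. G z *v w (y + z)))" for y
    unfolding f_def by (rule has_bochner_integral_bounded_linear[OF bl Gw'])
  \<comment> \<open>The majorant for Fubini: integrating the norm over \<open>z\<close> first leaves
    a multiple of the integrable \<open>norm (H y)\<close>.\<close>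
  have f_le: "(LINT z|lborel. norm (f y z)) \<le> norm (H y) * (L * sup_norm v * C)" for y
  proof -
    have "(LINT z|lborel. norm (f y z)) \<le> (LINT z|lborel. norm (H y) * C * norm (G (z - y) *v w z))"
    proof (rule integral_mono)
      show "integrable lborel (\<lambda>z. norm (f y z))"
        using fint[of y] by (auto simp: has_bochner_integral_iff)
      show "integrable lborel (\<lambda>z. norm (H y) * C * norm (G (z - y) *v w z))"
        using Gw[of y] by (auto simp: has_bochner_integral_iff)
      show "norm (f y z) \<le> norm (H y) * C * norm (G (z - y) *v w z)" for z
        unfolding f_def using C(2)[of "H y" "G (z - y) *v w z"] by (simp add: mult_ac)
    qed
    also have "\<dots> = norm (H y) * C * (LINT z|lborel. norm (G z *v w (y + z)))"
      using Gw[of y] by (simp add: has_bochner_integral_iff)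
    also have "\<dots> \<le> norm (H y) * C * (L * sup_norm v)"
    proof (rule mult_left_mono)
      show "(LINT z|lborel. norm (G z *v w (y + z))) \<le> L * sup_norm v"
        by (rule L(3)[OF _ w]) measurable
    qed (use C(1) in simp)
    finally show ?thesis by (simp add: mult_ac)
  qed
  have prod_int: "integrable (lborel \<Otimes>\<^sub>M lborel) (case_prod f)"
  proof (rule lborel_pair.Fubini_integrable)
    have "integrable lborel (\<lambda>y. norm (H y) * (L * sup_norm v * C))"
      using H by (intro integrable_mult_left integrable_norm)
    then show "integrable lborel (\<lambda>y. LINT z|lborel. norm (case_prod f (y, z)))"
    proof (rule Bochner_Integration.integrable_bound)
      show "AE y in lborel. norm (LINT z|lborel. norm (case_prod f (y, z))) \<le>
          norm (norm (H y) * (L * sup_norm v * C))"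
        using f_le by (auto intro!: AE_I2 order_trans[OF _ abs_ge_self])
    qed measurable
    show "AE y in lborel. integrable lborel (\<lambda>z. case_prod f (y, z))"
      using fint by (auto simp: has_bochner_integral_iff)
  qed measurable
  have "kernel_op H R (kernel_op G Q v) x =
      (LINT y|lborel. H y *v (LINT z|lborel. G z *v v (Q (R x - y) - z)))"
    by (simp add: kernel_op_def)
  \<comment> \<open>Radiality inserts \<open>Q\<close> into the argument of \<open>H\<close>, which
    makes the whole integrand a function of \<open>Q y\<close>.\<close>
  also have "\<dots> = (LINT y|lborel. H (Q y) *v (LINT z|lborel. G z *v w (Q y + z)))"
    by (simp add: radial[OF orthogonal_transformation_norm[OF Q]] w_def a_def diff_diff_eq
        linear_diff[OF orthogonal_transformation_linear[OF Q]])
  also have "\<dots> = (LINT y|lborel. H y *v (LINT z|lborel. G z *v w (y + z)))"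
    by (rule integral_lborel_orthogonal[OF Q]) measurable
  also have "\<dots> = (LINT y|lborel. LINT z|lborel. f y z)"
    using fint by (simp add: has_bochner_integral_iff)
  also have "\<dots> = (LINT z|lborel. LINT y|lborel. f y z)"
    by (rule lborel_pair.Fubini_integral[symmetric, OF prod_int])
  also have "\<dots> = (LINT z|lborel. P z *v w z)"
  proof (rule Bochner_Integration.integral_cong[OF refl])
    fix z
    have "bounded_linear (\<lambda>X :: complex^'n^'n. X *v w z)"
      by (rule bounded_bilinear.bounded_linear_left[OF bounded_bilinear_matrix_vector_mult])
    from has_bochner_integral_bounded_linear[OF this conv]
    show "(LINT y|lborel. f y z) = P z *v w z"
      by (simp add: f_def matrix_vector_mul_assoc has_bochner_integral_iff)
  qed
  finally show ?thesis
    by (simp add: kernel_op_def w_def a_def)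
qed

section \<open>The Ornstein-Uhlenbeck semigroup\<close>

definition ou_kernel ::
  "complex^'n^'n \<Rightarrow> complex^'n \<Rightarrow> complex^'n \<Rightarrow> real \<Rightarrow> real^'d \<Rightarrow> complex^'n^'n" where
  "ou_kernel Y a b t y =
    diag_conj Y (\<chi> k. exp (- of_real t * b $ k) * gauss_kernel (of_real t * a $ k) y)"

lemma ou_kernel_radial:
  fixes x y :: "real^'d"
  shows "norm x = norm y \<Longrightarrow> ou_kernel Y a b t x = ou_kernel Y a b t y"
  using gauss_kernel_radial[of x y] by (simp add: ou_kernel_def)

text \<open>The vector is the finite sum of its coordinates, each embedded by the bounded linear map
  \<open>axis k\<close>.\<close>

lemma has_bochner_integral_vec_lambda:
  fixes f :: "'n::finite \<Rightarrow> 'a \<Rightarrow> complex"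
  assumes "\<And>k. has_bochner_integral M (f k) (I k)"
  shows "has_bochner_integral M (\<lambda>x. \<chi> k. f k x) (\<chi> k. I k)"
proof -
  have "linear (axis k :: complex \<Rightarrow> complex^'n)" for k
    by (rule linearI) (simp_all add: axis_def vec_eq_iff)
  then have "bounded_linear (axis k :: complex \<Rightarrow> complex^'n)" for k
    by (simp add: linear_conv_bounded_linear)
  from has_bochner_integral_bounded_linear[OF this assms]
  have "has_bochner_integral M (\<lambda>x. \<Sum>k\<in>UNIV. axis k (f k x)) (\<Sum>k\<in>UNIV. axis k (I k) :: complex^'n)"
    by (rule has_bochner_integral_sum)
  moreover have "(\<Sum>k\<in>UNIV. axis k (g k)) = (\<chi> k. g k)" for g :: "'n \<Rightarrow> complex"
    by (simp add: vec_eq_iff axis_def)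
  ultimately show ?thesis by simp
qed

context
  fixes Y :: "complex^'n^'n" and a b :: "complex^'n"
  assumes Y: "invertible Y" and a: "\<And>k. Re (a $ k) > 0"
begin

lemma integrable_ou_kernel:
  assumes t: "t > 0"
  shows "integrable lborel (ou_kernel Y a b t :: real^'d \<Rightarrow> _)"
proof -
  have "has_bochner_integral lborel (\<lambda>y::real^'d. exp (- of_real t * b $ k) * gauss_kernel (of_real t * a $ k) y)
      (exp (- of_real t * b $ k) * 1)" for k
    using a t by (intro has_bochner_integral_mult_right has_bochner_integral_gauss_kernel) simp
  then have "has_bochner_integral lborel
      (\<lambda>y::real^'d. \<chi> k. exp (- of_real t * b $ k) * gauss_kernel (of_real t * a $ k) y)
      (\<chi> k. exp (- of_real t * b $ k) * 1)"
    by (rule has_bochner_integral_vec_lambda)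
  from has_bochner_integral_bounded_linear[OF bounded_linear_diag_conj this]
  show ?thesis
    unfolding ou_kernel_def[abs_def] has_bochner_integral_iff by (rule conjunct1)
qed

text \<open>Matrices that are diagonal in the basis \<open>Y\<close> multiply entrywise, so the
  matrix convolution splits into scalar Gaussian convolutions, while the factors with
  \<open>b\<close> obey the law of exponents.\<close>

lemma ou_kernel_conv:
  assumes s: "s > 0" and t: "t > 0"
  shows "has_bochner_integral lborel (\<lambda>y. ou_kernel Y a b t y ** ou_kernel Y a b s (z - y))
    (ou_kernel Y a b (t + s) z)"
proof -
  let ?f = "\<lambda>y k. exp (- of_real (t + s) * b $ k) *
    (gauss_kernel (of_real s * a $ k) (z - y) * gauss_kernel (of_real t * a $ k) y)"
  have "has_bochner_integral lborel (\<lambda>y. ?f y k)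
      (exp (- of_real (t + s) * b $ k) * gauss_kernel (of_real (s + t) * a $ k) z)" for k
    by (intro has_bochner_integral_mult_right has_bochner_integral_gauss_kernel_conv a s t)
  then have "has_bochner_integral lborel (\<lambda>y. \<chi> k. ?f y k)
      (\<chi> k. exp (- of_real (t + s) * b $ k) * gauss_kernel (of_real (s + t) * a $ k) z)"
    by (rule has_bochner_integral_vec_lambda)
  from has_bochner_integral_bounded_linear[OF bounded_linear_diag_conj this]
  have "has_bochner_integral lborel (\<lambda>y. diag_conj Y (\<chi> k. ?f y k)) (ou_kernel Y a b (t + s) z)"
    unfolding ou_kernel_def by (simp only: add.commute)
  have "exp (- of_real (t + s) * c) * (g * h) = exp (- of_real t * c) * h * (exp (- of_real s * c) * g)"
    for c g h :: complex
  proof -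
    have "- of_real (t + s) * c = - of_real t * c + - of_real s * c"
      by (simp add: algebra_simps)
    then show ?thesis by (simp only: exp_add mult_ac)
  qed
  from this[symmetric] \<open>has_bochner_integral lborel (\<lambda>y. diag_conj Y (\<chi> k. ?f y k)) (ou_kernel Y a b (t + s) z)\<close>
  show ?thesis
    unfolding ou_kernel_def diag_conj_mult[OF Y] vec_lambda_beta by (simp only:)
qed

text \<open>The common \<open>Y\<close> makes the whole exponent a single \<open>diag_conj\<close>,
  so the power, the inverse and the exponential all act on the diagonal entries alone.\<close>

lemma heat_kernel_eq:
  fixes S :: "real^'d^'d"
  assumes A: "A = diag_conj Y a" and B: "B = diag_conj Y b" and t: "t > 0"
  shows "heat_kernel A B S x \<xi> t = ou_kernel Y a b t (mat_exp (t *\<^sub>R S) *v x - \<xi>)"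
proof -
  note lin = bounded_linear.linear[OF bounded_linear_diag_conj]
  have a0: "a $ k \<noteq> 0" for k using a[of k] by auto
  define n where "n = norm (mat_exp (t *\<^sub>R S) *v x - \<xi>)"
  have "mat_neg_half_power CARD('d) ((4 * pi * t) *\<^sub>R A) =
      diag_conj Y (\<chi> k. exp (- (of_nat CARD('d) / 2) * Ln (4 * of_real pi * (of_real t * a $ k))))"
    unfolding A linear_scale[OF lin, symmetric] mat_neg_half_power_def diag_fun_diag_conj[OF Y]
      vector_scaleR_component
    by (simp add: scaleR_conv_of_real mult_ac)
  moreover have "matrix_inv ((4 * t) *\<^sub>R A) = diag_conj Y (\<chi> k. inverse (4 * (of_real t * a $ k)))"
    unfolding A linear_scale[OF lin, symmetric]
    using a0 t
    by (subst matrix_inv_diag_conj[OF Y]; simp only: vector_scaleR_component)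
       (simp_all add: scaleR_conv_of_real mult_ac)
  then have eq: "- (t *\<^sub>R B) - n\<^sup>2 *\<^sub>R matrix_inv ((4 * t) *\<^sub>R A) =
      diag_conj Y (- (t *\<^sub>R b) - n\<^sup>2 *\<^sub>R (\<chi> k. inverse (4 * (of_real t * a $ k))))"
    by (simp only: B linear_scale[OF lin] linear_neg[OF lin] linear_diff[OF lin])
  have "(- (t *\<^sub>R b) - n\<^sup>2 *\<^sub>R (\<chi> k. inverse (4 * (of_real t * a $ k)))) $ k =
      - of_real t * b $ k - of_real (n\<^sup>2) / (4 * (of_real t * a $ k))" for k
    unfolding vector_minus_component vector_uminus_component vector_scaleR_component vec_lambda_beta
    unfolding scaleR_conv_of_real divide_inverse by simp
  then have "mat_exp (- (t *\<^sub>R B) - n\<^sup>2 *\<^sub>R matrix_inv ((4 * t) *\<^sub>R A)) =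
      diag_conj Y (\<chi> k. exp (- of_real t * b $ k - of_real (n\<^sup>2) / (4 * (of_real t * a $ k))))"
    unfolding eq mat_exp_diag_conj[OF Y] by (simp only:)
  moreover have "E * exp (u - w / q) = exp u * (E * exp (- w / q))" for E u w q :: complex
    using exp_add[of u "- w / q"] by simp
  ultimately show ?thesis
    unfolding heat_kernel_def n_def[symmetric] ou_kernel_def gauss_kernel_def
    by (simp only: diag_conj_mult[OF Y] vec_lambda_beta) simp
qed

end

section \<open>Linearity of the kernel operators\<close>

lemma kernel_op_add:
  assumes "integrable lborel H" "u \<in> C_b" "v \<in> C_b"
  shows "kernel_op H R (\<lambda>x. u x + v x) = (\<lambda>x. kernel_op H R u x + kernel_op H R v x)"
  using assms by (simp add: fun_eq_iff kernel_op_def matrix_vector_right_distrib kernel_op_integrable)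

lemma bounded_linear_vector_scalar_mult: "bounded_linear (\<lambda>w :: complex^'n. c *s w)"
proof -
  have "linear (\<lambda>w :: complex^'n. c *s w)"
    by (rule linearI) (simp_all add: vec_eq_iff algebra_simps)
  then show ?thesis
    by (simp add: linear_conv_bounded_linear)
qed

lemma C_b_scale:
  assumes v: "v \<in> C_b"
  shows "(\<lambda>x. c *s v x) \<in> C_b"
proof -
  obtain D where D: "D > 0" "\<And>w. norm (c *s w :: complex^'b) \<le> norm w * D"
    using bounded_linear.pos_bounded[OF bounded_linear_vector_scalar_mult] by blast
  have "norm (c *s v x) \<le> sup_norm v * D" for x
    using D(1) norm_le_sup_norm[OF v] by (intro order_trans[OF D(2)] mult_right_mono) auto
  moreover have "continuous_on UNIV (\<lambda>x. c *s v x)"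
    using v by (intro bounded_linear.continuous_on[OF bounded_linear_vector_scalar_mult]) (simp add: C_b_iff)
  ultimately show ?thesis
    unfolding C_b_iff by blast
qed

lemma kernel_op_scale:
  fixes v :: "real^'d \<Rightarrow> complex^'n"
  assumes "integrable lborel H" "v \<in> C_b"
  shows "kernel_op H R (\<lambda>x. c *s v x) = (\<lambda>x. c *s kernel_op H R v x)"
proof
  fix x
  from integral_bounded_linear[OF bounded_linear_vector_scalar_mult kernel_op_integrable[OF assms, of "R x"]]
  show "kernel_op H R (\<lambda>x. c *s v x) x = c *s kernel_op H R v x"
    by (simp add: kernel_op_def vector_scalar_commute)
qed

theorem theorem6p2:
  fixes A B :: "complex^'n^'n"
    and S :: "real^'d^'d"
    and \<theta> :: "real^'d \<Rightarrow> real"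
    and \<eta> :: real
  assumes "CARD('d) \<ge> 2"
    and "simultaneously_diagonalizable A B"
    and "\<And>\<mu>. mat_eigenvalue A \<mu> \<Longrightarrow> Re \<mu> > 0"
    and "skew_symmetric S"
    and "\<eta> \<ge> 0"
    and "weight_function \<eta> \<theta>"
    and "radial \<theta>"
  shows "(\<forall>t>0. \<forall>v \<in> (C_b :: (real^'d \<Rightarrow> complex^'n) set). ou_integrable A B S t v) \<and>
    operator_semigroup_on (C_b :: (real^'d \<Rightarrow> complex^'n) set) (ou_semigroup A B S) \<and>
    operator_semigroup_on (C_ub :: (real^'d \<Rightarrow> complex^'n) set) (ou_semigroup A B S) \<and>
    operator_semigroup_on (C_rub S :: (real^'d \<Rightarrow> complex^'n) set) (ou_semigroup A B S)"
proof -
  obtain Y :: "complex^'n^'n" and a' b' where Y: "invertible Y"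
    and A': "A = Y ** diag_mat a' ** matrix_inv Y" and B': "B = Y ** diag_mat b' ** matrix_inv Y"
    using assms(2) unfolding simultaneously_diagonalizable_def by blast
  define a b where "a = vec_lambda a'" and "b = vec_lambda b'"
  have A: "A = diag_conj Y a" and B: "B = diag_conj Y b"
    by (simp_all add: A' B' a_def b_def diag_conj_def vec_nth_vec_lambda)
  have a: "Re (a $ k) > 0" for k
    using assms(3) mat_eigenvalue_diag_conj[OF Y] unfolding A by blast
  define R where "R t = ((*v) (mat_exp (t *\<^sub>R S)))" for t
  define H :: "real \<Rightarrow> real^'d \<Rightarrow> complex^'n^'n" where "H = ou_kernel Y a b"
  have R: "orthogonal_transformation (R t)" for t
    using orthogonal_mat_exp_skew[OF assms(4)] by (simp add: R_def orthogonal_transformation_matrix)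
  have R_add: "R s \<circ> R t = R (t + s)" for s t
    by (simp add: R_def fun_eq_iff matrix_vector_mul_assoc mat_exp_scaleR_add add.commute)
  \<comment> \<open>Exponentials of multiples of one matrix commute; the invariance of
    \<open>C_rub S\<close> rests on this.\<close>
  have comm: "R t (mat_exp (s *\<^sub>R S) *v x) = mat_exp (s *\<^sub>R S) *v R t x" for s t x
    by (simp add: R_def matrix_vector_mul_assoc mat_exp_scaleR_add add.commute)
  have H: "integrable lborel (H t)" if "t > 0" for t
    unfolding H_def using integrable_ou_kernel[OF Y a that] .
  have radial: "norm x = norm y \<Longrightarrow> H t x = H t y" for t x y
    unfolding H_def by (rule ou_kernel_radial)
  have ou: "has_bochner_integral lborel (\<lambda>\<xi>. heat_kernel A B S x \<xi> t *v v \<xi>) (kernel_op (H t) (R t) v x)"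
    if t: "t > 0" and v: "v \<in> C_b" for t v x
  proof -
    have "has_bochner_integral lborel (\<lambda>y. H t y *v v (R t x - y)) (kernel_op (H t) (R t) v x)"
      using kernel_op_integrable[OF H[OF t] v] by (simp add: has_bochner_integral_iff kernel_op_def)
    \<comment> \<open>The substitution \<open>y = R t x - \<xi>\<close> recovers the heat kernel.
      Integrability comes along, so the default value 0 of the Bochner integral is never
      met.\<close>
    from has_bochner_integral_lborel_reflection[OF this, of "R t x"]
    show ?thesis
      by (simp add: heat_kernel_eq[OF Y a A B t] H_def R_def)
  qed
  then have T: "ou_semigroup A B S t v = kernel_op (H t) (R t) v" if "t > 0" "v \<in> C_b" for t v
    using that by (auto simp: ou_semigroup_def fun_eq_iff has_bochner_integral_iff)
  \<comment> \<open>One argument for all three spaces: linearity, the bound and the composition law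
    hold on \<open>C_b\<close>, and only the invariance for \<open>t > 0\<close> has to be supplied
    for each \<open>X\<close>.\<close>
  have semigroup: "operator_semigroup_on X (ou_semigroup A B S)"
    if X: "X \<subseteq> C_b" and inv: "\<And>t v. t > 0 \<Longrightarrow> v \<in> X \<Longrightarrow> kernel_op (H t) (R t) v \<in> X" for X
    unfolding operator_semigroup_on_def
  proof (intro conjI allI impI ballI)
    fix t :: real assume "t \<ge> 0"
    show "bounded_linear_operator_on X (ou_semigroup A B S t)"
    proof (cases "t = 0")
      case True
      then show ?thesis
        by (auto simp: bounded_linear_operator_on_def ou_semigroup_def intro: exI[of _ 1])
    next
      case False
      with \<open>t \<ge> 0\<close> have t: "t > 0" by simp
      obtain K where K: "\<And>v. v \<in> C_b \<Longrightarrow> sup_norm (kernel_op (H t) (R t) v) \<le> K * sup_norm v"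
        by (rule kernel_op_bound[OF H[OF t]]) blast
      have add: "(\<lambda>x. u x + v x) \<in> C_b" if "u \<in> C_b" "v \<in> C_b" for u v :: "real^'d \<Rightarrow> complex^'n"
        using that unfolding C_b_def by (rule plus_cont)
      show ?thesis
        unfolding bounded_linear_operator_on_def
        using X inv[OF t] K t
        by (auto simp: T add C_b_scale kernel_op_add[OF H] kernel_op_scale[OF H] subset_iff intro!: exI[of _ K])
    qed
  next
    fix v assume "v \<in> X"
    show "ou_semigroup A B S 0 v = v"
      by (simp add: ou_semigroup_def)
  next
    fix s t :: real and v assume st: "s \<ge> 0" "t \<ge> 0" and v: "v \<in> X"
    show "ou_semigroup A B S t (ou_semigroup A B S s v) = ou_semigroup A B S (t + s) v"
    proof (cases "s = 0 \<or> t = 0")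
      case True
      then show ?thesis by (auto simp: ou_semigroup_def)
    next
      case False
      with st have s: "s > 0" and t: "t > 0" by auto
      have vb: "v \<in> C_b" "kernel_op (H s) (R s) v \<in> C_b"
        using X v inv[OF s v] by auto
      have conv: "has_bochner_integral lborel (\<lambda>y. H t y ** H s (z - y)) (H (t + s) z)" for z
        unfolding H_def by (rule ou_kernel_conv[OF Y a s t])
      have "kernel_op (H t) (R t) (kernel_op (H s) (R s) v) x = kernel_op (H (t + s)) (R s \<circ> R t) v x" for x
        by (rule kernel_op_kernel_op[OF H[OF t] H[OF s] R R radial conv vb(1)])
      then show ?thesis
        using s t vb by (simp add: T R_add fun_eq_iff)
    qed
  qed
  have "ou_integrable A B S t v" if "t > 0" "v \<in> C_b" for t and v :: "real^'d \<Rightarrow> complex^'n"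
    using ou[OF that] by (auto simp: ou_integrable_def has_bochner_integral_iff)
  moreover have "operator_semigroup_on C_b (ou_semigroup A B S)"
    using kernel_op_C_b[OF H R] by (intro semigroup) auto
  moreover have "operator_semigroup_on C_ub (ou_semigroup A B S)"
    using kernel_op_C_ub[OF H R] by (intro semigroup) (auto simp: C_ub_def)
  moreover have "operator_semigroup_on (C_rub S) (ou_semigroup A B S)"
    using kernel_op_C_rub[OF H R _ assms(4) radial comm]
    by (intro semigroup) (auto simp: C_rub_def C_ub_def)
  ultimately show ?thesis by blast
qed

end
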